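(* Let $N\ge 1$ and let $f:\{0,1\}^N\to\{0,1\}$ be a (total) Boolean function. Then $D(f)\le 4096\, Q_2(f)^6$.
   Context: Deterministic decision trees: $D(f)$ is the minimum, over all deterministic classical algorithms (decision trees) that compute $f(X)$ for every $X\in\{0,1\}^N$ by adaptively querying individual bits $x_i$ of $X$, of the worst-case number of queries (the depth of the tree). Quantum networks: the input $X=(x_0,\ldots,x_{N-1})\in\{0,1\}^N$ is given as a black-box. A quantum network with $T$ queries acts on $m$ qubits (for some $m$) and is a sequence of unitary transformations $U_0,O,U_1,O,\ldots,U_{T-1},O,U_T$ applied in this order to the initial state $|0\rangle$, where the $U_j$ are arbitrary unitaries on $m$ qubits not depending on $X$, and the query $O$ (depending on $X$) maps each basis state $|i,b,z\rangle$ to $|i,b\oplus x_i,z\rangle$; here $i$ consists of $\lceil\log_2 N\rceil$ bits, $b$ is one bit, and $z$ consists of the remaining $m-\lceil\log_2 N\rceil-1$ bits (if $i\ge N$, the query leaves the basis state unchanged). The output is the value obtained by measuring the rightmost bit of the final state in the computational basis. The network computes $f$ with bounded error if for every $X\in\{0,1\}^N$ the output equals $f(X)$ with probability at least $2/3$. $Q_2(f)$ is the minimum $T$ such that some quantum network with $T$ queries computes $f$ with bounded error. *)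

theory Defs
  imports Complex_Main "Jordan_Normal_Form.Schur_Decomposition"
begin

text \<open>
  An input in \<open>{0,1}\<^sup>N\<close> is a \<open>bool list\<close> of length \<open>N\<close>. A Boolean function on \<open>{0,1}\<^sup>N\<close> is given
  as \<open>f :: bool list \<Rightarrow> bool\<close>; only its values on lists of length \<open>N\<close> are ever used.
\<close>

section \<open>Deterministic decision trees\<close>

text \<open>\<open>Query i l r\<close> queries the bit \<open>x\<^sub>i\<close> and continues with \<open>l\<close> if it is 0 and with \<open>r\<close> if it is 1.\<close>

datatype dtree = Answer bool | Query nat dtree dtree

fun queried_vars :: "dtree \<Rightarrow> nat set" where
  "queried_vars (Answer c) = {}"
| "queried_vars (Query i l r) = insert i (queried_vars l \<union> queried_vars r)"

fun depth :: "dtree \<Rightarrow> nat" where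
  "depth (Answer c) = 0"
| "depth (Query i l r) = Suc (max (depth l) (depth r))"

fun run_dtree :: "dtree \<Rightarrow> bool list \<Rightarrow> bool" where
  "run_dtree (Answer c) X = c"
| "run_dtree (Query i l r) X = run_dtree (if X ! i then r else l) X"

definition dtree_computes :: "nat \<Rightarrow> dtree \<Rightarrow> (bool list \<Rightarrow> bool) \<Rightarrow> bool" where
  "dtree_computes N t f \<longleftrightarrow>
     queried_vars t \<subseteq> {..<N} \<and> (\<forall>X. length X = N \<longrightarrow> run_dtree t X = f X)"

definition D_complexity :: "nat \<Rightarrow> (bool list \<Rightarrow> bool) \<Rightarrow> nat" where
  "D_complexity N f = (LEAST d. \<exists>t. dtree_computes N t f \<and> depth t = d)"

section \<open>Quantum networks\<close>

definition index_bits :: "nat \<Rightarrow> nat" where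
  "index_bits N = nat \<lceil>log 2 (real N)\<rceil>"

text \<open>
  The basis states of \<open>m\<close> qubits are numbered by \<open>0, \<dots>, 2\<^sup>m - 1\<close>, the bit string being read in binary
  with the rightmost bit least significant. So \<open>|i,b,z\<rangle>\<close>, where \<open>z\<close> has
  \<open>w = m - index_bits N - 1\<close> bits, has number \<open>(2 * i + b) * 2\<^sup>w + z\<close>. The definitions below are
  only meant for \<open>m \<ge> index_bits N + 1\<close>, which \<open>bounded_error_network\<close> requires.
\<close>

definition query_index :: "nat \<Rightarrow> nat \<Rightarrow> bool list \<Rightarrow> nat \<Rightarrow> nat" where
  "query_index N m X k =
     (let w = m - index_bits N - 1;
          z = k mod 2 ^ w;
          b = k div 2 ^ w mod 2;
          i = k div 2 ^ (w + 1)
      in if i < N then (2 * i + (b + of_bool (X ! i)) mod 2) * 2 ^ w + z else k)"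

definition query_mat :: "nat \<Rightarrow> nat \<Rightarrow> bool list \<Rightarrow> complex mat" where
  "query_mat N m X =
     mat (2 ^ m) (2 ^ m) (\<lambda>(r, c). if r = query_index N m X c then 1 else 0)"

definition unitary_mat :: "nat \<Rightarrow> complex mat \<Rightarrow> bool" where
  "unitary_mat n U \<longleftrightarrow>
     U \<in> carrier_mat n n \<and> mat_adjoint U * U = 1\<^sub>m n \<and> U * mat_adjoint U = 1\<^sub>m n"

text \<open>\<open>network_state N m U X t\<close> is \<open>U\<^sub>t O U\<^bsub>t-1\<^esub> O \<dots> U\<^sub>1 O U\<^sub>0 |0\<rangle>\<close>.\<close>

fun network_state :: "nat \<Rightarrow> nat \<Rightarrow> (nat \<Rightarrow> complex mat) \<Rightarrow> bool list \<Rightarrow> nat \<Rightarrow> complex vec" where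
  "network_state N m U X 0 = U 0 *\<^sub>v unit_vec (2 ^ m) 0"
| "network_state N m U X (Suc t) = U (Suc t) *\<^sub>v (query_mat N m X *\<^sub>v network_state N m U X t)"

text \<open>The rightmost bit of the basis state number \<open>k\<close> is 1 iff \<open>k\<close> is odd.\<close>

definition output_prob ::
    "nat \<Rightarrow> nat \<Rightarrow> (nat \<Rightarrow> complex mat) \<Rightarrow> nat \<Rightarrow> bool list \<Rightarrow> bool \<Rightarrow> real" where
  "output_prob N m U T X c =
     (\<Sum>k | k < 2 ^ m \<and> odd k = c. (cmod (network_state N m U X T $ k))\<^sup>2)"

definition bounded_error_network ::
    "nat \<Rightarrow> nat \<Rightarrow> (nat \<Rightarrow> complex mat) \<Rightarrow> nat \<Rightarrow> (bool list \<Rightarrow> bool) \<Rightarrow> bool" where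
  "bounded_error_network N m U T f \<longleftrightarrow>
     index_bits N + 1 \<le> m \<and>
     (\<forall>j\<le>T. unitary_mat (2 ^ m) (U j)) \<and>
     (\<forall>X. length X = N \<longrightarrow> output_prob N m U T X (f X) \<ge> 2 / 3)"

definition Q2_complexity :: "nat \<Rightarrow> (bool list \<Rightarrow> bool) \<Rightarrow> nat" where
  "Q2_complexity N f = (LEAST T. \<exists>m U. bounded_error_network N m U T f)"

end

theory Submission
  imports Defs "HOL-Library.Disjoint_Sets" "HOL-Library.Countable"
begin

text \<open>
  Let \<open>b\<close> bound the number of disjoint sensitive blocks (blocks of bits whose flipping changes \<open>f\<close>)
  of every input. Every input has a certificate of at most \<open>b\<^sup>2\<close> bits: the union of a maximal family
  of disjoint minimal sensitive blocks. A decision tree that queries \<open>b\<close> times a certificate of a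
  1-input consistent with the bits seen so far computes \<open>f\<close>, so \<open>D(f) \<le> b\<^sup>3\<close>.

  The probability of an output of a network with \<open>T\<close> queries is a multilinear polynomial of degree
  at most \<open>n = 2 T\<close> in the indicator variables of a set \<open>S\<close> of disjoint sensitive blocks to be flipped.
  Choosing \<open>S\<close> at random, with each block present with probability \<open>x\<close>, turns it into a polynomial \<open>p\<close>
  of degree at most \<open>n\<close> in \<open>x\<close> with \<open>0 \<le> p \<le> 1\<close> on \<open>{0..1}\<close>. Since flipping a single block changes the
  probability by at least \<open>1/3\<close>, \<open>\<bar>p' 0\<bar>\<close> is at least a third of the number of blocks, whereas
  \<open>\<bar>p' 0\<bar> \<le> n\<^sup>2\<close> by Markov's inequality at an endpoint. This gives \<open>b \<le> 12 T\<^sup>2\<close>.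
\<close>

section \<open>Riesz interpolation\<close>

text \<open>For \<open>n > 0\<close> and \<open>r < 2 * n\<close> these are the zeros of cos (n
  \<theta>) between 0 and 2 \<pi>.\<close>

definition riesz_node :: "nat \<Rightarrow> nat \<Rightarrow> real" where
  "riesz_node n r = (2 * real r + 1) * pi / (2 * real n)"

text \<open>At a node t the sine is the sign (-1)^r and \<open>1 - cos t\<close> equals 2 (sin (t /
  2))^2, so for \<open>n > 0\<close> these are M. Riesz's weights (-1)^r / (4 n (sin (t /
  2))^2).\<close>

definition riesz_weight :: "nat \<Rightarrow> nat \<Rightarrow> real" where
  "riesz_weight n r =
     sin (real n * riesz_node n r) / (2 * real n * (1 - cos (riesz_node n r)))"

lemma cos_less_one:
  fixes x :: real
  assumes "0 < x" "x < 2 * pi"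
  shows "cos x < 1"
proof -
  have "sin (x / 2) > 0"
    using assms by (intro sin_gt_zero) auto
  moreover have "cos x = 1 - 2 * (sin (x / 2))\<^sup>2"
    using cos_double_sin[of "x / 2"] by simp
  ultimately show ?thesis by simp
qed

lemma riesz_node_bounds:
  assumes "r < 2 * n"
  shows "0 < riesz_node n r" "riesz_node n r < 2 * pi"
proof -
  have n: "n > 0" using assms by simp
  show "0 < riesz_node n r" unfolding riesz_node_def using n by (simp add: add_nonneg_pos)
  have "2 * real r + 1 < 4 * real n" using assms by linarith
  then have "(2 * real r + 1) * pi < 4 * real n * pi" by simp
  then show "riesz_node n r < 2 * pi"
    unfolding riesz_node_def using n by (simp add: field_simps)
qed

lemma cis_riesz_node:
  assumes "n > 0"
  shows "cos (real n * riesz_node n r) = 0" and "\<bar>sin (real n * riesz_node n r)\<bar> = 1"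
    and "cis (2 * real n * riesz_node n r) = -1"
proof -
  have eq: "real n * riesz_node n r = real r * pi + pi / 2"
    using assms by (simp add: riesz_node_def field_simps)
  show c: "cos (real n * riesz_node n r) = 0"
    unfolding eq by (simp add: cos_add)
  then show "\<bar>sin (real n * riesz_node n r)\<bar> = 1"
    using sin_cos_squared_add[of "real n * riesz_node n r"] by (simp add: abs_square_eq_1)
  have "2 * real n * riesz_node n r = 2 * pi * real r + pi"
    using arg_cong[OF eq, of "\<lambda>x. 2 * x"] by (simp add: algebra_simps)
  moreover have "cis (2 * pi * real r + pi) = cis (2 * pi * real r) * cis pi"
    by (simp only: cis_mult)
  ultimately show "cis (2 * real n * riesz_node n r) = -1" by simp
qed

text \<open>A geometric sum whose ratio \<open>q\<close> is a root of unity of order dividing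
  \<open>2 * n\<close> and differs from 1.\<close>

lemma sum_cis_riesz_node:
  assumes "0 < j" "j < 2 * n"
  shows "(\<Sum>r<2*n. cis (real j * riesz_node n r)) = 0"
proof -
  define q where "q = cis (real j * pi / real n)"
  have n: "n > 0" using assms by simp
  have "real j * pi / real n < 2 * pi"
    using assms n by (simp add: field_simps)
  then have "cos (real j * pi / real n) < 1"
    using assms n by (intro cos_less_one) auto
  then have q: "q \<noteq> 1" by (auto simp: q_def complex_eq_iff)
  have "q ^ (2 * n) = cis (2 * pi * real j)"
    unfolding q_def DeMoivre using n by (simp add: field_simps)
  then have qn: "q ^ (2 * n) = 1" by (simp add: complex_eq_iff)
  have "cis (real j * riesz_node n r) = cis (real j * pi / (2 * real n)) * q ^ r" for r
    unfolding q_def DeMoivre cis_mult riesz_node_def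
    using n by (intro arg_cong[of _ _ cis]) (simp add: field_simps)
  then have "(\<Sum>r<2*n. cis (real j * riesz_node n r))
      = cis (real j * pi / (2 * real n)) * (\<Sum>r<2*n. q ^ r)"
    by (simp add: sum_distrib_left)
  also have "(\<Sum>r<2*n. q ^ r) = 0"
    using q qn by (simp add: geometric_sum)
  finally show ?thesis by simp
qed

text \<open>
  M. Riesz's interpolation formula \<open>t' \<theta> = \<Sum>\<^sub>r w\<^sub>r t (\<theta> + \<theta>\<^sub>r)\<close> for trigonometric polynomials \<open>t\<close> of degree
  at most \<open>n\<close> amounts to \<open>riesz_sum n k = \<i> k\<close> for \<open>\<bar>k\<bar> \<le> n\<close>.
  In this range \<open>riesz_sum n\<close> has vanishing second differences, hence is affine, and its two
  coefficients are determined by the antiperiodicity.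
\<close>

definition riesz_sum :: "nat \<Rightarrow> int \<Rightarrow> complex" where
  "riesz_sum n k = (\<Sum>r<2*n. of_real (riesz_weight n r) * cis (of_int k * riesz_node n r))"

lemma riesz_sum_antiperiodic:
  "riesz_sum n (k + 2 * int n) = - riesz_sum n k"
proof (cases "n = 0")
  case False
  have "cis (of_int (k + 2 * int n) * riesz_node n r) = - cis (of_int k * riesz_node n r)" for r
  proof -
    have "cis (of_int (k + 2 * int n) * riesz_node n r)
        = cis (of_int k * riesz_node n r) * cis (2 * real n * riesz_node n r)"
      by (simp add: cis_mult ring_distribs)
    then show ?thesis using cis_riesz_node(3)[of n r] False by simp
  qed
  then show ?thesis by (simp add: riesz_sum_def sum_negf)
qed (simp add: riesz_sum_def)

text \<open>Second differences multiply each term by \<open>2 * cos t - 2\<close>, which cancels the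
  denominator of the weight. As cos (n t) vanishes at the nodes, the remaining sine is a multiple of
  \<open>cis (n * t)\<close>, so a pure exponential sum is left; it vanishes for
  \<open>\<bar>k\<bar> < n\<close>.\<close>

lemma riesz_sum_second_difference:
  assumes "n > 0"
  shows "riesz_sum n (k + 1) - 2 * riesz_sum n k + riesz_sum n (k - 1)
    = \<i> / of_nat n * (\<Sum>r<2*n. cis (of_int (k + int n) * riesz_node n r))"
proof -
  have "of_real (riesz_weight n r) * cis (of_int (k + 1) * riesz_node n r)
      - 2 * (of_real (riesz_weight n r) * cis (of_int k * riesz_node n r))
      + of_real (riesz_weight n r) * cis (of_int (k - 1) * riesz_node n r)
      = \<i> / of_nat n * cis (of_int (k + int n) * riesz_node n r)" if r: "r < 2 * n" for r
  proof -
    define t where "t = riesz_node n r"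
    have c: "1 - cos t \<noteq> 0"
      using cos_less_one[OF riesz_node_bounds[OF r]] by (simp add: t_def)
    have "cis (of_int (k + 1) * t) + cis (of_int (k - 1) * t) - 2 * cis (of_int k * t)
        = cis (of_int k * t) * (cis t + cis (- t) - 2)"
      by (simp add: cis_mult ring_distribs)
    also have "cis t + cis (- t) - 2 = of_real (2 * cos t - 2)"
      by (simp add: complex_eq_iff)
    finally have 1: "cis (of_int (k + 1) * t) + cis (of_int (k - 1) * t) - 2 * cis (of_int k * t)
        = cis (of_int k * t) * of_real (2 * cos t - 2)" .
    have 2: "riesz_weight n r * (2 * cos t - 2) = - sin (real n * t) / real n"
      using c assms by (simp add: riesz_weight_def t_def field_simps)
    have 3: "of_real (sin (real n * t)) = - \<i> * cis (real n * t)"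
      using cis_riesz_node(1)[OF assms, of r] by (simp add: complex_eq_iff t_def)
    have "of_real (riesz_weight n r) * cis (of_int (k + 1) * t)
      - 2 * (of_real (riesz_weight n r) * cis (of_int k * t))
      + of_real (riesz_weight n r) * cis (of_int (k - 1) * t)
      = of_real (riesz_weight n r) * (cis (of_int k * t) * of_real (2 * cos t - 2))"
      unfolding 1[symmetric] by (simp add: algebra_simps)
    also have "\<dots> = cis (of_int k * t) * of_real (riesz_weight n r * (2 * cos t - 2))"
      by simp
    also have "\<dots> = cis (of_int k * t) * (\<i> * cis (real n * t) / of_nat n)"
      unfolding 2 by (simp only: of_real_divide of_real_minus 3) simp
    also have "\<dots> = \<i> / of_nat n * cis (of_int (k + int n) * t)"
      by (simp add: cis_mult ring_distribs flip: cis_mult)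
    finally show ?thesis unfolding t_def .
  qed
  then show ?thesis
    unfolding riesz_sum_def sum_distrib_left
    by (simp flip: sum_subtractf sum.distrib)
qed

lemma riesz_sum_eq:
  assumes n: "n > 0" and k: "\<bar>k\<bar> \<le> int n"
  shows "riesz_sum n k = \<i> * of_int k"
proof -
  define F where "F j = riesz_sum n (int j - int n)" for j
  define \<delta> where "\<delta> = F 1 - F 0"
  have step: "F (j + 2) - 2 * F (j + 1) + F j = 0" if "j + 1 < 2 * n" for j
    using riesz_sum_second_difference[OF n, of "int j + 1 - int n"]
      sum_cis_riesz_node[of "j + 1" n] that by (simp add: F_def algebra_simps)
  have lin: "F j = F 0 + of_nat j * \<delta> \<and> F (Suc j) = F 0 + of_nat (Suc j) * \<delta>"
    if "j < 2 * n" for j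
    using that
  proof (induction j)
    case 0
    then show ?case by (simp add: \<delta>_def)
  next
    case (Suc j)
    then have "F (Suc (Suc j)) = 2 * F (Suc j) - F j"
      using step[of j] by (simp add: algebra_simps)
    then show ?case using Suc by (simp add: algebra_simps)
  qed
  have lin': "F j = F 0 + of_nat j * \<delta>" if "j \<le> 2 * n" for j
    using lin[of j] lin[of "j - 1"] that n by (cases "j = 2 * n") auto
  \<comment> \<open>Antiperiodicity ties the two ends of the affine range together and so fixes the
    intercept in terms of the slope.\<close>
  have "F (2 * n) = - F 0"
    using riesz_sum_antiperiodic[of n "- int n"] by (simp add: F_def)
  with lin'[of "2 * n"] have e: "F 0 + 2 * (of_nat n * \<delta>) = - F 0"
    by (simp add: mult.assoc)
  have "2 * (F 0 + of_nat n * \<delta>) = F 0 + (F 0 + 2 * (of_nat n * \<delta>))"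
    by (simp add: distrib_left)
  also have "\<dots> = 0" unfolding e by simp
  finally have "F 0 + of_nat n * \<delta> = 0"
    by (simp del: distrib_left_numeral)
  then have F0: "F 0 = - (of_nat n * \<delta>)"
    by (simp add: eq_neg_iff_add_eq_0)
  \<comment> \<open>The slope comes from the second difference at \<open>k = n\<close>: there every
    term of the exponential sum is -1, and antiperiodicity brings the value at \<open>n + 1\<close>
    back to \<open>F 1\<close>.\<close>
  have cisN: "(\<Sum>r<2*n. cis (of_int (int n + int n) * riesz_node n r)) = - of_nat (2 * n)"
  proof -
    have "cis (of_int (int n + int n) * riesz_node n r) = -1" for r
      using cis_riesz_node(3)[OF n, of r] by simp
    then show ?thesis by simp
  qed
  have "riesz_sum n (int n + 1) = - F 1"
    using riesz_sum_antiperiodic[of n "1 - int n"] by (simp add: F_def algebra_simps)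
  moreover have "riesz_sum n (int n) = F (2 * n)" "riesz_sum n (int n - 1) = F (2 * n - 1)"
    using n by (simp_all add: F_def of_nat_diff)
  moreover have "\<i> / of_nat n * (- of_nat (2 * n)) = - 2 * \<i>"
    using n by simp
  ultimately have "- F 1 - 2 * F (2 * n) + F (2 * n - 1) = - 2 * \<i>"
    using riesz_sum_second_difference[OF n, of "int n"] unfolding cisN by metis
  moreover have "F (2 * n - 1) = F 0 + (2 * of_nat n - 1) * \<delta>"
    using lin'[of "2 * n - 1"] n by (simp add: of_nat_diff)
  moreover have "F (2 * n) = F 0 + 2 * of_nat n * \<delta>" "F 1 = F 0 + \<delta>"
    using lin'[of "2 * n"] lin'[of 1] n by simp_all
  ultimately have "- (F 0 + \<delta>) - 2 * (F 0 + 2 * of_nat n * \<delta>)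
      + (F 0 + (2 * of_nat n - 1) * \<delta>) = - 2 * \<i>" by simp
  then have "- 2 * \<delta> = - 2 * \<i>" unfolding F0 by (simp add: algebra_simps)
  then have d: "\<delta> = \<i>" by simp
  have "int (nat (k + int n)) = k + int n" using k by linarith
  then have "riesz_sum n k = F (nat (k + int n))" by (simp add: F_def)
  also have "\<dots> = - (of_nat n * \<i>) + of_nat (nat (k + int n)) * \<i>"
    using lin'[of "nat (k + int n)"] k F0 d by simp
  also have "of_nat (nat (k + int n)) = (of_int (k + int n) :: complex)"
    using k by (simp add: of_nat_nat)
  finally show ?thesis by (simp add: algebra_simps)
qed

text \<open>Each weight has the sign of sin (n t) at its node, so the absolute values add up to the
  imaginary part of \<open>riesz_sum n n\<close>: interpolation applied to the extremal function sin
  (n \<theta>).\<close>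

lemma sum_abs_riesz_weight:
  assumes n: "n > 0"
  shows "(\<Sum>r<2*n. \<bar>riesz_weight n r\<bar>) = real n"
proof -
  have "\<bar>riesz_weight n r\<bar> = riesz_weight n r * sin (real n * riesz_node n r)" if "r < 2 * n" for r
  proof -
    have "1 - cos (riesz_node n r) > 0"
      using cos_less_one[OF riesz_node_bounds[OF that]] by simp
    moreover have "sin (real n * riesz_node n r) = 1 \<or> sin (real n * riesz_node n r) = -1"
      using cis_riesz_node(2)[OF n, of r] by linarith
    ultimately show ?thesis using n by (auto simp: riesz_weight_def)
  qed
  then have "(\<Sum>r<2*n. \<bar>riesz_weight n r\<bar>)
      = (\<Sum>r<2*n. riesz_weight n r * sin (real n * riesz_node n r))" by simp
  also have "\<dots> = Im (riesz_sum n (int n))" by (simp add: riesz_sum_def)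
  also have "\<dots> = real n" using riesz_sum_eq[OF n, of "int n"] by simp
  finally show ?thesis .
qed

text \<open>Interpolating twice yields the second derivative at 0, here of u^j exp (i k \<theta>)
  with u = (1 - cos \<theta>) / 2. As u vanishes to second order, nothing survives for
  \<open>j \<ge> 2\<close>. General \<open>k\<close> is needed for the induction because a factor u
  shifts frequencies by one.\<close>

lemma riesz_product_sum:
  fixes n :: nat
  defines "u \<equiv> \<lambda>r s. (1 - cos (riesz_node n r + riesz_node n s)) / 2"
  assumes n: "n > 0" and k: "\<bar>k\<bar> + int j \<le> int n"
  shows "(\<Sum>r<2*n. \<Sum>s<2*n. of_real (riesz_weight n r * riesz_weight n s * u r s ^ j)
            * cis (of_int k * (riesz_node n r + riesz_node n s)))
    = (if j = 0 then - (of_int k)\<^sup>2 else if j = 1 then 1 / 2 else 0)"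
  using k
proof (induction j arbitrary: k)
  case 0
  have "(\<Sum>r<2*n. \<Sum>s<2*n. of_real (riesz_weight n r * riesz_weight n s * u r s ^ 0)
            * cis (of_int k * (riesz_node n r + riesz_node n s))) = riesz_sum n k * riesz_sum n k"
    unfolding riesz_sum_def sum_product
    by (intro sum.cong refl) (simp add: ring_distribs flip: cis_mult)
  also have "\<dots> = - (of_int k)\<^sup>2"
    using riesz_sum_eq[OF n, of k] 0 by (simp add: power_mult_distrib flip: power2_eq_square)
  finally show ?case by simp
next
  case (Suc j)
  define G where "G k = (\<Sum>r<2*n. \<Sum>s<2*n.
      of_real (riesz_weight n r * riesz_weight n s * u r s ^ j)
      * cis (of_int k * (riesz_node n r + riesz_node n s)))" for k
  define e where "e k t = cis (of_int k * t)" for k t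
  have key: "of_real (u r s) * e k (riesz_node n r + riesz_node n s)
      = 1 / 2 * e k (riesz_node n r + riesz_node n s)
        - 1 / 4 * e (k + 1) (riesz_node n r + riesz_node n s)
        - 1 / 4 * e (k - 1) (riesz_node n r + riesz_node n s)" for r s
  proof -
    define t where "t = riesz_node n r + riesz_node n s"
    have "of_real (u r s) = 1 / 2 - 1 / 4 * cis t - 1 / 4 * cis (- t)"
      using cos_minus[of t] sin_minus[of t] by (simp add: u_def complex_eq_iff flip: t_def)
    then have "of_real (u r s) * e k t
      = 1 / 2 * e k t - 1 / 4 * (e k t * cis t) - 1 / 4 * (e k t * cis (- t))"
      by (simp only: left_diff_distrib) (simp add: mult_ac)
    then show ?thesis
      by (simp add: e_def cis_mult ring_distribs flip: t_def)
  qed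
  have "of_real (a * u r s ^ Suc j) * e k (riesz_node n r + riesz_node n s)
      = 1 / 2 * (of_real (a * u r s ^ j) * e k (riesz_node n r + riesz_node n s))
        - 1 / 4 * (of_real (a * u r s ^ j) * e (k + 1) (riesz_node n r + riesz_node n s))
        - 1 / 4 * (of_real (a * u r s ^ j) * e (k - 1) (riesz_node n r + riesz_node n s))" for a r s
  proof -
    have "of_real (a * u r s ^ Suc j) * e k (riesz_node n r + riesz_node n s)
        = of_real (a * u r s ^ j) * (of_real (u r s) * e k (riesz_node n r + riesz_node n s))"
      by simp
    then show ?thesis unfolding key by (simp only: right_diff_distrib mult.left_commute)
  qed
  then have rec: "(\<Sum>r<2*n. \<Sum>s<2*n. of_real (riesz_weight n r * riesz_weight n s * u r s ^ Suc j)
      * cis (of_int k * (riesz_node n r + riesz_node n s)))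
      = 1 / 2 * G k - 1 / 4 * G (k + 1) - 1 / 4 * G (k - 1)"
    unfolding G_def sum_distrib_left e_def
    by (simp only: sum_subtractf[symmetric])
  have G: "G l = (if j = 0 then - (of_int l)\<^sup>2 else if j = 1 then 1 / 2 else 0)"
    if "\<bar>l\<bar> + int j \<le> int n" for l
    unfolding G_def using that by (rule Suc.IH)
  \<comment> \<open>For \<open>j = 0\<close> the squares combine to 1 / 2; for larger
    \<open>j\<close> the three values of \<open>G\<close> coincide and the coefficients
    cancel.\<close>
  have "1 / 2 * G k - 1 / 4 * G (k + 1) - 1 / 4 * G (k - 1) = (if j = 0 then 1 / 2 else 0)"
    using G[of k] G[of "k + 1"] G[of "k - 1"] Suc.prems
    by (auto simp: power2_eq_square field_simps)
  with rec show ?case by simp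
qed

section \<open>Multilinear functions of bounded degree\<close>

text \<open>
  The multilinear functions of degree at most \<open>d\<close> in the indicator variables of a set \<open>S\<close>:
  \<open>of_bool (R \<subseteq> S)\<close> is the monomial \<open>\<Prod>j\<in>R. x\<^sub>j\<close>.
\<close>

inductive multilinear_degree_le :: "nat \<Rightarrow> ('a set \<Rightarrow> complex) \<Rightarrow> bool" for d where
  zero: "multilinear_degree_le d (\<lambda>S. 0)"
| add_monomial: "multilinear_degree_le d g \<Longrightarrow> finite R \<Longrightarrow> card R \<le> d \<Longrightarrow>
    multilinear_degree_le d (\<lambda>S. g S + c * of_bool (R \<subseteq> S))"

section \<open>Closure properties of multilinear functions\<close>

lemma multilinear_monomial:
  "finite R \<Longrightarrow> card R \<le> d \<Longrightarrow> multilinear_degree_le d (\<lambda>S. c * of_bool (R \<subseteq> S))"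
  using multilinear_degree_le.add_monomial[OF multilinear_degree_le.zero] by simp

lemma multilinear_const: "multilinear_degree_le d (\<lambda>S. c)"
  using multilinear_monomial[of "{}" d c] by simp

lemma multilinear_add:
  assumes "multilinear_degree_le d g" "multilinear_degree_le d h"
  shows "multilinear_degree_le d (\<lambda>S. g S + h S)"
  using assms(2)
proof induction
  case (add_monomial h R c)
  then show ?case
    using multilinear_degree_le.add_monomial[of d "\<lambda>S. g S + h S" R c] by (simp add: add.assoc)
qed (use assms in simp)

lemma multilinear_sum:
  "(\<And>i. i \<in> I \<Longrightarrow> multilinear_degree_le d (g i)) \<Longrightarrow> multilinear_degree_le d (\<lambda>S. \<Sum>i\<in>I. g i S)"
  by (induction I rule: infinite_finite_induct) (auto intro: multilinear_add multilinear_const)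

text \<open>Indicator variables satisfy x^2 = x, so the monomials of \<open>Q\<close> and
  \<open>R\<close> multiply to that of \<open>Q \<union> R\<close>.\<close>

lemma multilinear_mult_monomial:
  assumes "multilinear_degree_le d g" "finite R" "card R \<le> e"
  shows "multilinear_degree_le (d + e) (\<lambda>S. g S * (c * of_bool (R \<subseteq> S)))"
  using assms(1)
proof induction
  case zero
  then show ?case by (simp add: multilinear_const)
next
  case (add_monomial g Q b)
  have "card (Q \<union> R) \<le> d + e"
    using card_Un_le[of Q R] add_monomial assms by linarith
  then have "multilinear_degree_le (d + e)
      (\<lambda>S. g S * (c * of_bool (R \<subseteq> S)) + (b * c) * of_bool (Q \<union> R \<subseteq> S))"
    using add_monomial assms by (intro multilinear_degree_le.add_monomial) auto
  moreover have "(\<lambda>S. g S * (c * of_bool (R \<subseteq> S)) + (b * c) * of_bool (Q \<union> R \<subseteq> S))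
      = (\<lambda>S. (g S + b * of_bool (Q \<subseteq> S)) * (c * of_bool (R \<subseteq> S)))"
    by (auto simp: fun_eq_iff algebra_simps)
  ultimately show ?case by simp
qed

lemma multilinear_mult:
  assumes "multilinear_degree_le d g" "multilinear_degree_le e h"
  shows "multilinear_degree_le (d + e) (\<lambda>S. g S * h S)"
  using assms(2)
proof induction
  case zero
  then show ?case by (simp add: multilinear_const)
next
  case (add_monomial h R c)
  then show ?case
    using multilinear_add[OF add_monomial.IH multilinear_mult_monomial[OF assms(1), of R e c]]
    by (simp add: distrib_left)
qed

lemma multilinear_cnj:
  assumes "multilinear_degree_le d g"
  shows "multilinear_degree_le d (\<lambda>S. cnj (g S))"
  using assms
proof induction
  case (add_monomial g R c)
  have "cnj (of_bool P) = of_bool P" for P by (cases P) auto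
  with add_monomial show ?case
    using multilinear_degree_le.add_monomial[of d "\<lambda>S. cnj (g S)" R "cnj c"] by simp
qed (simp add: multilinear_const)

lemma multilinear_degree_0:
  assumes "multilinear_degree_le 0 g"
  shows "g S = g {}"
  using assms by induction auto

text \<open>The expectation of \<open>g\<close> at a random subset of \<open>A\<close> containing each element with probability \<open>x\<close>.\<close>

definition bernoulli_mean :: "'a set \<Rightarrow> ('a set \<Rightarrow> complex) \<Rightarrow> real \<Rightarrow> complex" where
  "bernoulli_mean A g x =
     (\<Sum>S\<in>Pow A. of_real (x ^ card S * (1 - x) ^ (card A - card S)) * g S)"

text \<open>By independence the random set contains \<open>R\<close> with probability x^|R|; a
  monomial of degree d thus becomes the power x^d.\<close>

lemma bernoulli_mean_monomial:
  assumes "finite A" "R \<subseteq> A"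
  shows "bernoulli_mean A (\<lambda>S. of_bool (R \<subseteq> S)) x = of_real (x ^ card R)"
proof -
  \<comment> \<open>Expanding the product picks the set \<open>S\<close> of elements that contribute
    \<open>x\<close>; the other factors vanish unless \<open>S\<close> contains
    \<open>R\<close>.\<close>
  have "(\<Prod>i\<in>A. x + (1 - x) * of_bool (i \<notin> R))
      = (\<Sum>S\<in>Pow A. (\<Prod>i\<in>S. x) * (\<Prod>i\<in>A-S. (1 - x) * of_bool (i \<notin> R)))"
    using assms by (intro prod_add)
  also have "\<dots> = (\<Sum>S\<in>Pow A. x ^ card S * (1 - x) ^ (card A - card S) * of_bool (R \<subseteq> S))"
  proof (intro sum.cong refl)
    fix S assume "S \<in> Pow A"
    then have S: "S \<subseteq> A" "finite S" using assms finite_subset by auto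
    have "(\<Prod>i\<in>A-S. of_bool (i \<notin> R)) = (of_bool (R \<subseteq> S) :: real)"
      using assms S by (auto simp: of_bool_def intro!: prod.neutral)
    then show "(\<Prod>i\<in>S. x) * (\<Prod>i\<in>A-S. (1 - x) * of_bool (i \<notin> R))
        = x ^ card S * (1 - x) ^ (card A - card S) * of_bool (R \<subseteq> S)"
      using S assms by (simp add: prod.distrib card_Diff_subset)
  qed
  also have "(\<Prod>i\<in>A. x + (1 - x) * of_bool (i \<notin> R)) = (\<Prod>i\<in>R. x)"
    using assms by (intro prod.mono_neutral_cong_right) auto
  finally have "of_real (x ^ card R) = (\<Sum>S\<in>Pow A.
      (of_real (x ^ card S * (1 - x) ^ (card A - card S) * of_bool (R \<subseteq> S)) :: complex))"
    by (simp only: prod_constant of_real_sum)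
  also have "\<dots> = bernoulli_mean A (\<lambda>S. of_bool (R \<subseteq> S)) x"
    unfolding bernoulli_mean_def by (intro sum.cong refl) simp
  finally show ?thesis ..
qed

lemma bernoulli_mean_monomial_outside:
  assumes "\<not> R \<subseteq> A"
  shows "bernoulli_mean A (\<lambda>S. of_bool (R \<subseteq> S)) x = 0"
  unfolding bernoulli_mean_def using assms by (intro sum.neutral) auto

lemma bernoulli_mean_linear:
  "bernoulli_mean A (\<lambda>S. g S + c * h S) x = bernoulli_mean A g x + c * bernoulli_mean A h x"
  by (simp add: bernoulli_mean_def ring_distribs sum.distrib sum_distrib_left mult.left_commute)

lemma norm_bernoulli_mean_le:
  assumes "finite A" "0 \<le> x" "x \<le> 1" "\<And>S. S \<subseteq> A \<Longrightarrow> norm (g S) \<le> M"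
  shows "norm (bernoulli_mean A g x) \<le> M"
proof -
  have "norm (bernoulli_mean A g x)
      \<le> (\<Sum>S\<in>Pow A. norm (of_real (x ^ card S * (1 - x) ^ (card A - card S)) * g S))"
    unfolding bernoulli_mean_def by (rule norm_sum)
  also have "\<dots> \<le> (\<Sum>S\<in>Pow A. x ^ card S * (1 - x) ^ (card A - card S) * M)"
  proof (intro sum_mono)
    fix S assume "S \<in> Pow A"
    moreover have "x ^ card S * (1 - x) ^ (card A - card S) \<ge> 0" using assms by simp
    ultimately show "norm (of_real (x ^ card S * (1 - x) ^ (card A - card S)) * g S)
        \<le> x ^ card S * (1 - x) ^ (card A - card S) * M"
      using assms(4)[of S]
      by (auto simp only: norm_mult norm_of_real abs_of_nonneg Pow_iff intro!: mult_left_mono)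
  qed
  also have "\<dots> = (\<Sum>S\<in>Pow A. x ^ card S * (1 - x) ^ (card A - card S)) * M"
    by (simp add: sum_distrib_right)
  \<comment> \<open>The weights are probabilities: their sum is the mean of the empty
    monomial.\<close>
  also have "(\<Sum>S\<in>Pow A. x ^ card S * (1 - x) ^ (card A - card S)) = 1"
  proof -
    have "of_real (\<Sum>S\<in>Pow A. x ^ card S * (1 - x) ^ (card A - card S)) = (1 :: complex)"
      using bernoulli_mean_monomial[of A "{}" x] assms by (simp add: bernoulli_mean_def)
    then show ?thesis by (simp only: of_real_eq_1_iff)
  qed
  finally show ?thesis by simp
qed

text \<open>
  \<open>bernoulli_mean A g\<close> is a polynomial \<open>p\<close> of degree at most \<open>n\<close> with derivative
  \<open>\<Sum>a\<in>A. g {a} - g {}\<close> at 0, and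
  \<open>p ((1 - cos \<theta>) / 2)\<close> is a trigonometric polynomial with second derivative \<open>p' 0 / 2\<close> at 0;
  the double sum below computes this second derivative from values of \<open>p\<close> on \<open>{0..1}\<close>.
\<close>

lemma bernoulli_mean_derivative:
  fixes n :: nat
  defines "u \<equiv> \<lambda>r s. (1 - cos (riesz_node n r + riesz_node n s)) / 2"
  assumes n: "n > 0" and A: "finite A" and g: "multilinear_degree_le n g"
  shows "(\<Sum>r<2*n. \<Sum>s<2*n. of_real (riesz_weight n r * riesz_weight n s)
            * bernoulli_mean A g (u r s)) = (\<Sum>a\<in>A. g {a} - g {}) / 2"
  using g
proof induction
  case zero
  then show ?case by (simp add: bernoulli_mean_def)
next
  case (add_monomial g R c)
  have mono: "(\<Sum>r<2*n. \<Sum>s<2*n. of_real (riesz_weight n r * riesz_weight n s)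
            * bernoulli_mean A (\<lambda>S. of_bool (R \<subseteq> S)) (u r s))
      = (\<Sum>a\<in>A. of_bool (R \<subseteq> {a}) - of_bool (R \<subseteq> {})) / 2"
  proof (cases "R \<subseteq> A")
    case True
    \<comment> \<open>Both sides vanish unless \<open>R\<close> is a singleton: the power x^|R| has
      a nonzero derivative at 0 only for exponent 1.\<close>
    have "(\<Sum>r<2*n. \<Sum>s<2*n. of_real (riesz_weight n r * riesz_weight n s)
            * bernoulli_mean A (\<lambda>S. of_bool (R \<subseteq> S)) (u r s)) = (if card R = 1 then 1 / 2 else 0)"
      using riesz_product_sum[OF n, of 0 "card R"] add_monomial.hyps
      by (simp add: bernoulli_mean_monomial[OF A True] u_def)
    also have "\<dots> = (\<Sum>a\<in>A. of_bool (R \<subseteq> {a}) - of_bool (R \<subseteq> {})) / 2"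
    proof (cases "card R = 1")
      case True
      then obtain b where b: "R = {b}" by (auto simp: card_1_singleton_iff)
      then have "of_bool (R \<subseteq> {a}) - of_bool (R \<subseteq> {}) = (if a = b then 1 else 0 :: complex)" for a
        by auto
      then show ?thesis using \<open>R \<subseteq> A\<close> b A by simp
    next
      case False
      then have "(R \<subseteq> {a}) = (R \<subseteq> {})" for a
        by (auto simp: subset_singleton_iff)
      then show ?thesis using False by simp
    qed
    finally show ?thesis .
  next
    case False
    then have "\<not> R \<subseteq> {a}" if "a \<in> A" for a using that by auto
    moreover have "\<not> R \<subseteq> {}" using False by auto
    ultimately have "(\<Sum>a\<in>A. of_bool (R \<subseteq> {a}) - of_bool (R \<subseteq> {})) = (0 :: complex)"
      by (intro sum.neutral) simp
    then show ?thesis by (simp only: bernoulli_mean_monomial_outside[OF False]) simp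
  qed
  have "(\<Sum>r<2*n. \<Sum>s<2*n. of_real (riesz_weight n r * riesz_weight n s)
            * bernoulli_mean A (\<lambda>S. g S + c * of_bool (R \<subseteq> S)) (u r s))
      = (\<Sum>a\<in>A. g {a} - g {}) / 2
        + c * ((\<Sum>a\<in>A. of_bool (R \<subseteq> {a}) - of_bool (R \<subseteq> {})) / 2)"
    unfolding bernoulli_mean_linear add_monomial.IH[symmetric] mono[symmetric]
    by (simp only: distrib_left sum.distrib sum_distrib_left mult.left_commute)
  also have "\<dots> = (\<Sum>a\<in>A. (g {a} + c * of_bool (R \<subseteq> {a})) - (g {} + c * of_bool (R \<subseteq> {}))) / 2"
    by (simp add: sum_subtractf sum.distrib sum_distrib_left[symmetric] algebra_simps
        add_divide_distrib diff_divide_distrib)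
  finally show ?case .
qed

text \<open>Markov's inequality at the endpoint 0: half of the derivative is a combination of means
  at points of \<open>{0..1}\<close> whose coefficients have absolute sum \<open>n\<^sup>2\<close>.
  Subtracting \<open>m\<close> changes no difference, so \<open>M\<close> need only be the radius of
  the range of \<open>g\<close>.\<close>

lemma sum_differences_le_degree_squared:
  fixes g :: "'a set \<Rightarrow> complex"
  assumes n: "n > 0" and A: "finite A" and g: "multilinear_degree_le n g"
    and bnd: "\<And>S. S \<subseteq> A \<Longrightarrow> norm (g S - m) \<le> M"
  shows "norm (\<Sum>a\<in>A. g {a} - g {}) \<le> 2 * real (n\<^sup>2) * M"
proof -
  define u where "u r s = (1 - cos (riesz_node n r + riesz_node n s)) / 2" for r s
  define w where "w = riesz_weight n"
  have g': "multilinear_degree_le n (\<lambda>S. g S + (- m) * of_bool ({} \<subseteq> S))"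
    by (rule add_monomial[OF g]) auto
  have u: "0 \<le> u r s" "u r s \<le> 1" for r s
    using cos_ge_minus_one[of "riesz_node n r + riesz_node n s"] by (auto simp: u_def)
  have "norm (\<Sum>a\<in>A. g {a} - g {}) / 2 = norm ((\<Sum>a\<in>A. g {a} - g {}) / 2)"
    by (simp add: norm_divide)
  also have "(\<Sum>a\<in>A. g {a} - g {}) / 2
      = (\<Sum>r<2*n. \<Sum>s<2*n. of_real (w r * w s) * bernoulli_mean A (\<lambda>S. g S - m) (u r s))"
    using bernoulli_mean_derivative[OF n A g'] by (simp add: u_def w_def)
  also have "norm \<dots> \<le> (\<Sum>r<2*n. \<Sum>s<2*n. \<bar>w r\<bar> * \<bar>w s\<bar> * M)"
    using u A bnd
    by (intro sum_norm_le)
       (auto simp: norm_mult abs_mult intro!: mult_left_mono norm_bernoulli_mean_le)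
  also have "\<dots> = (\<Sum>r<2*n. \<bar>w r\<bar>) * (\<Sum>s<2*n. \<bar>w s\<bar>) * M"
    by (simp add: sum_product sum_distrib_right sum_distrib_left mult_ac)
  also have "\<dots> = real (n\<^sup>2) * M"
    using sum_abs_riesz_weight[OF n] by (simp add: w_def power2_eq_square)
  finally show ?thesis by simp
qed

section \<open>Sensitive blocks, certificates and decision trees\<close>

definition flip :: "bool list \<Rightarrow> nat set \<Rightarrow> bool list" where
  "flip X S = map (\<lambda>i. X ! i \<noteq> (i \<in> S)) [0..<length X]"

lemma length_flip [simp]: "length (flip X S) = length X"
  by (simp add: flip_def)

lemma nth_flip [simp]: "i < length X \<Longrightarrow> flip X S ! i = (X ! i \<noteq> (i \<in> S))"
  by (simp add: flip_def)

lemma flip_empty [simp]: "flip X {} = X"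
  by (simp add: list_eq_iff_nth_eq)

definition sensitive :: "(bool list \<Rightarrow> bool) \<Rightarrow> bool list \<Rightarrow> nat set \<Rightarrow> bool" where
  "sensitive f X S \<longleftrightarrow> S \<subseteq> {..<length X} \<and> f (flip X S) \<noteq> f X"

definition sensitive_family :: "(bool list \<Rightarrow> bool) \<Rightarrow> bool list \<Rightarrow> nat set set \<Rightarrow> bool" where
  "sensitive_family f X \<B> \<longleftrightarrow> disjoint \<B> \<and> (\<forall>S\<in>\<B>. sensitive f X S)"

definition agree_on :: "nat set \<Rightarrow> bool list \<Rightarrow> bool list \<Rightarrow> bool" where
  "agree_on K X Y \<longleftrightarrow> (\<forall>i\<in>K. X ! i = Y ! i)"

lemma sensitive_nonempty: "sensitive f X S \<Longrightarrow> S \<noteq> {}"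
  by (auto simp: sensitive_def)

lemma sensitive_difference:
  assumes "length Y = length X" "f Y \<noteq> f X"
  shows "sensitive f X {i. i < length X \<and> X ! i \<noteq> Y ! i}"
proof -
  have "flip X {i. i < length X \<and> X ! i \<noteq> Y ! i} = Y"
    using assms(1) by (auto simp: list_eq_iff_nth_eq)
  then show ?thesis using assms(2) by (auto simp: sensitive_def)
qed

lemma sensitive_family_finite:
  assumes "sensitive_family f X \<B>"
  shows "finite \<B>"
proof (rule finite_subset)
  show "\<B> \<subseteq> Pow {..<length X}" using assms by (auto simp: sensitive_family_def sensitive_def)
qed simp

text \<open>Sensitive blocks are nonempty, so a block disjoint from the family is new and increases
  its cardinality.\<close>

lemma sensitive_family_insert:
  assumes "sensitive_family f X \<B>" "sensitive f X S" "S \<inter> \<Union>\<B> = {}"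
  shows "sensitive_family f X (insert S \<B>)" "S \<notin> \<B>"
proof -
  show "S \<notin> \<B>" using assms sensitive_nonempty by blast
  show "sensitive_family f X (insert S \<B>)"
    using assms unfolding sensitive_family_def
    by (auto simp: disjoint_def pairwise_insert disjnt_def)
qed

lemma exists_minimal_sensitive:
  assumes "sensitive f X S"
  shows "\<exists>S'\<subseteq>S. sensitive f X S' \<and> (\<forall>R. R \<subset> S' \<longrightarrow> \<not> sensitive f X R)"
proof -
  have "finite S" using assms finite_subset by (auto simp: sensitive_def)
  then have "finite {R. R \<subseteq> S \<and> sensitive f X R}" by simp
  moreover have "{R. R \<subseteq> S \<and> sensitive f X R} \<noteq> {}" using assms by auto
  ultimately obtain S' where "S' \<in> {R. R \<subseteq> S \<and> sensitive f X R}"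
    "\<And>R. R \<in> {R. R \<subseteq> S \<and> sensitive f X R} \<Longrightarrow> R \<subseteq> S' \<Longrightarrow> S' = R"
    using finite_has_minimal[of "{R. R \<subseteq> S \<and> sensitive f X R}"] by metis
  then show ?thesis by (intro exI[of _ S']) blast
qed

text \<open>Once \<open>S\<close> is flipped, flipping back one of its bits leaves a proper subset
  flipped and restores the value \<open>f X\<close>. Hence the singletons in \<open>S\<close> form a
  sensitive family of \<open>flip X S\<close>.\<close>

lemma card_minimal_sensitive:
  assumes bs: "\<And>X \<B>. length X = N \<Longrightarrow> sensitive_family f X \<B> \<Longrightarrow> card \<B> \<le> b"
    and len: "length X = N" and S: "sensitive f X S" and min: "\<And>R. R \<subset> S \<Longrightarrow> \<not> sensitive f X R"
  shows "card S \<le> b"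
proof -
  have sub: "S \<subseteq> {..<length X}" using S by (simp add: sensitive_def)
  have "sensitive f (flip X S) {i}" if i: "i \<in> S" for i
  proof -
    have "flip (flip X S) {i} = flip X (S - {i})"
      using i by (auto simp: list_eq_iff_nth_eq)
    moreover have "f (flip X (S - {i})) = f X"
      using min[of "S - {i}"] i sub by (auto simp: sensitive_def)
    ultimately show ?thesis using S i by (auto simp: sensitive_def)
  qed
  then have "sensitive_family f (flip X S) ((\<lambda>i. {i}) ` S)"
    by (auto simp: sensitive_family_def disjoint_def)
  then have "card ((\<lambda>i. {i}) ` S) \<le> b"
    using bs[of "flip X S"] len by simp
  then show ?thesis by (simp add: card_image)
qed

lemma exists_certificate:
  assumes bs: "\<And>X \<B>. length X = N \<Longrightarrow> sensitive_family f X \<B> \<Longrightarrow> card \<B> \<le> b"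
    and len: "length X = N"
  shows "\<exists>C\<subseteq>{..<N}. card C \<le> b\<^sup>2 \<and> (\<forall>Y. length Y = N \<longrightarrow> agree_on C Y X \<longrightarrow> f Y = f X)"
proof -
  \<comment> \<open>The bound on block sizes stands in for minimality: minimal sensitive blocks
    satisfy it, and the size estimate uses only it.\<close>
  define F where "F = {\<B>. sensitive_family f X \<B> \<and> (\<forall>S\<in>\<B>. card S \<le> b)}"
  have "F \<subseteq> Pow (Pow {..<N})"
    using len by (auto simp: F_def sensitive_family_def sensitive_def)
  then have fin: "finite F" by (rule finite_subset) simp
  moreover have "{} \<in> F" by (simp add: F_def sensitive_family_def)
  ultimately obtain \<B> where \<B>: "\<B> \<in> F" and max: "\<And>\<C>. \<C> \<in> F \<Longrightarrow> \<B> \<subseteq> \<C> \<Longrightarrow> \<B> = \<C>"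
    using finite_has_maximal[of F] by (metis empty_iff)
  have sf: "sensitive_family f X \<B>" using \<B> by (simp add: F_def)
  show ?thesis
  proof (intro exI[of _ "\<Union>\<B>"] conjI allI impI)
    show "\<Union>\<B> \<subseteq> {..<N}" using sf len by (auto simp: sensitive_family_def sensitive_def)
    have "card (\<Union>\<B>) \<le> sum card \<B>"
      by (rule card_Union_le_sum_card) 
    also have "\<dots> \<le> card \<B> * b"
      using \<B> sum_bounded_above[of \<B> card b] by (simp add: F_def)
    also have "\<dots> \<le> b\<^sup>2" using bs[OF len sf] by (simp add: power2_eq_square)
    finally show "card (\<Union>\<B>) \<le> b\<^sup>2" .
  next
    fix Y assume Y: "length Y = N" "agree_on (\<Union>\<B>) Y X"
    show "f Y = f X"
    proof (rule ccontr)
      assume "f Y \<noteq> f X"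
      then have "sensitive f X {i. i < length X \<and> X ! i \<noteq> Y ! i}"
        using Y len by (intro sensitive_difference) auto
      \<comment> \<open>A minimal sensitive block among the positions where \<open>Y\<close>
        deviates from \<open>X\<close> avoids the whole family, so it could be added.\<close>
      from exists_minimal_sensitive[OF this] obtain S where
        "S \<subseteq> {i. i < length X \<and> X ! i \<noteq> Y ! i} \<and> sensitive f X S \<and>
          (\<forall>R. R \<subset> S \<longrightarrow> \<not> sensitive f X R)" ..
      then have S: "S \<subseteq> {i. i < length X \<and> X ! i \<noteq> Y ! i}" "sensitive f X S"
          "\<And>R. R \<subset> S \<Longrightarrow> \<not> sensitive f X R" by simp_all
      have disj: "S \<inter> \<Union>\<B> = {}" using S(1) Y(2) by (auto simp: agree_on_def)
      have "insert S \<B> \<in> F"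
        using sensitive_family_insert(1)[OF sf S(2) disj] \<B> card_minimal_sensitive[OF bs len S(2,3)]
        by (auto simp: F_def)
      then show False
        using max[of "insert S \<B>"] sensitive_family_insert(2)[OF sf S(2) disj] by blast
    qed
  qed
qed

text \<open>\<open>K\<close> is the set of known bits and \<open>X\<close> matters only through its
  values there, which record the answers. Every answer pattern on \<open>C\<close> has a
  continuation of depth at most \<open>d\<close>.\<close>

lemma query_all:
  assumes "finite C" "C \<subseteq> {..<N}" "length X = N"
    and "\<And>Y. length Y = N \<Longrightarrow> agree_on K Y X \<Longrightarrow>
      \<exists>t. queried_vars t \<subseteq> {..<N} \<and> depth t \<le> d \<and>
          (\<forall>Z. length Z = N \<longrightarrow> agree_on (K \<union> C) Z Y \<longrightarrow> run_dtree t Z = f Z)"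
  shows "\<exists>t. queried_vars t \<subseteq> {..<N} \<and> depth t \<le> card C + d \<and>
          (\<forall>Z. length Z = N \<longrightarrow> agree_on K Z X \<longrightarrow> run_dtree t Z = f Z)"
  using assms
proof (induction C arbitrary: K X rule: finite_induct)
  case empty
  show ?case using empty(3)[of X] empty(2) by (simp add: agree_on_def)
next
  case (insert i C)
  have i: "i < N" using insert.prems by simp
  \<comment> \<open>\<open>v\<close> is the answer at \<open>i\<close>. For a bit in
    \<open>K\<close> only one answer is possible and no query is spent.\<close>
  have "\<exists>t. queried_vars t \<subseteq> {..<N} \<and> depth t \<le> card C + d \<and>
          (\<forall>Z. length Z = N \<longrightarrow> agree_on (insert i K) Z (X[i := v]) \<longrightarrow> run_dtree t Z = f Z)"
    if v: "v = X ! i \<or> i \<notin> K" for v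
  proof (rule insert.IH)
    fix Y assume "length Y = N" "agree_on (insert i K) Y (X[i := v])"
    then have "agree_on K Y X"
      using v i insert.prems by (auto simp: agree_on_def nth_list_update)
    then show "\<exists>t. queried_vars t \<subseteq> {..<N} \<and> depth t \<le> d \<and>
          (\<forall>Z. length Z = N \<longrightarrow> agree_on (insert i K \<union> C) Z Y \<longrightarrow> run_dtree t Z = f Z)"
      using insert.prems(3)[OF \<open>length Y = N\<close>] by simp
  qed (use insert.prems in auto)
  note sub = this
  show ?case
  proof (cases "i \<in> K")
    case True
    then obtain t where "queried_vars t \<subseteq> {..<N}" "depth t \<le> card C + d"
        "\<And>Z. length Z = N \<Longrightarrow> agree_on K Z X \<Longrightarrow> run_dtree t Z = f Z"
      using sub[of "X ! i"] by (auto simp: insert_absorb)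
    then show ?thesis using insert.hyps by (intro exI[of _ t]) auto
  next
    case False
    obtain l where
      l: "queried_vars l \<subseteq> {..<N}" "depth l \<le> card C + d"
        "\<And>Z. length Z = N \<Longrightarrow> agree_on (insert i K) Z (X[i := False]) \<Longrightarrow> run_dtree l Z = f Z"
      using sub[of False] False by blast
    obtain r where
      r: "queried_vars r \<subseteq> {..<N}" "depth r \<le> card C + d"
        "\<And>Z. length Z = N \<Longrightarrow> agree_on (insert i K) Z (X[i := True]) \<Longrightarrow> run_dtree r Z = f Z"
      using sub[of True] False by blast
    have agree: "agree_on (insert i K) Z (X[i := Z ! i])" if "length Z = N" "agree_on K Z X" for Z
      using that i insert.prems(2) by (auto simp: agree_on_def nth_list_update)
    then have "run_dtree (Query i l r) Z = f Z" if "length Z = N" "agree_on K Z X" for Z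
      using agree[OF that] that(1) l(3)[of Z] r(3)[of Z] by (cases "Z ! i") auto
    then show ?thesis
      using l r i insert.hyps by (intro exI[of _ "Query i l r"]) auto
  qed
qed

text \<open>
  Querying a certificate of a 1-input consistent with the known bits \<open>K\<close> decreases the bound \<open>k\<close>:
  the bits of a 0-input that deviate from the certificate form one more sensitive block, which
  is disjoint from all sensitive blocks among the bits that are still unknown.
\<close>

lemma exists_dtree_aux:
  assumes cert: "\<And>X. length X = N \<Longrightarrow> \<exists>C\<subseteq>{..<N}. card C \<le> c \<and>
      (\<forall>Y. length Y = N \<longrightarrow> agree_on C Y X \<longrightarrow> f Y = f X)"
    and "length X = N"
    and "\<And>Y \<B>. length Y = N \<Longrightarrow> agree_on K Y X \<Longrightarrow> \<not> f Y \<Longrightarrow> sensitive_family f Y \<B> \<Longrightarrow>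
        \<Union>\<B> \<inter> K = {} \<Longrightarrow> card \<B> \<le> k"
  shows "\<exists>t. queried_vars t \<subseteq> {..<N} \<and> depth t \<le> k * c \<and>
          (\<forall>Z. length Z = N \<longrightarrow> agree_on K Z X \<longrightarrow> run_dtree t Z = f Z)"
  using assms(2-)
proof (induction k arbitrary: K X)
  case 0
  show ?case
  proof (cases "\<exists>Y. length Y = N \<and> agree_on K Y X \<and> \<not> f Y")
    case True
    then obtain Y where Y: "length Y = N" "agree_on K Y X" "\<not> f Y" by blast
    \<comment> \<open>A consistent 1-input would differ from \<open>Y\<close> in a sensitive block
      outside \<open>K\<close>, contradicting the bound 0.\<close>
    have "\<not> f Z" if Z: "length Z = N" "agree_on K Z X" for Z
    proof
      assume "f Z"
      then have "sensitive f Y {i. i < length Y \<and> Y ! i \<noteq> Z ! i}"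
        using Y Z by (intro sensitive_difference) auto
      then have "sensitive_family f Y {{i. i < length Y \<and> Y ! i \<noteq> Z ! i}}"
        by (simp add: sensitive_family_def)
      from 0(2)[OF Y this] show False
        using Y Z by (auto simp: agree_on_def)
    qed
    then show ?thesis by (intro exI[of _ "Answer False"]) auto
  next
    case False
    then show ?thesis by (intro exI[of _ "Answer True"]) auto
  qed
next
  case (Suc k)
  show ?case
  proof (cases "\<exists>W. length W = N \<and> agree_on K W X \<and> f W")
    case True
    then obtain W where W: "length W = N" "agree_on K W X" "f W" by blast
    from cert[OF W(1)] obtain C where C: "C \<subseteq> {..<N}" "card C \<le> c"
      "\<And>Y. length Y = N \<Longrightarrow> agree_on C Y W \<Longrightarrow> f Y" using W(3) by blast
    have "\<exists>t. queried_vars t \<subseteq> {..<N} \<and> depth t \<le> card C + k * c \<and>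
          (\<forall>Z. length Z = N \<longrightarrow> agree_on K Z X \<longrightarrow> run_dtree t Z = f Z)"
    proof (rule query_all)
      show "finite C" using C(1) finite_subset by blast
      fix A assume A: "length A = N" "agree_on K A X"
      show "\<exists>t. queried_vars t \<subseteq> {..<N} \<and> depth t \<le> k * c \<and>
          (\<forall>Z. length Z = N \<longrightarrow> agree_on (K \<union> C) Z A \<longrightarrow> run_dtree t Z = f Z)"
      proof (rule Suc.IH[OF A(1)])
        fix Y \<B> assume Y: "length Y = N" "agree_on (K \<union> C) Y A" "\<not> f Y"
          and \<B>: "sensitive_family f Y \<B>" "\<Union>\<B> \<inter> (K \<union> C) = {}"
        have YX: "agree_on K Y X" using Y(2) A(2) by (auto simp: agree_on_def)
        \<comment> \<open>Flipping \<open>S\<close> makes \<open>Y\<close> agree with the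
          certificate of \<open>W\<close>. \<open>S\<close> avoids \<open>K\<close> because
          \<open>Y\<close> and \<open>W\<close> both agree with \<open>X\<close> there.\<close>
        define S where "S = {i \<in> C. Y ! i \<noteq> W ! i}"
        have "f (flip Y S)"
          using C(1) Y(1) by (intro C(3)) (auto simp: agree_on_def S_def)
        then have S: "sensitive f Y S"
          using C(1) Y by (auto simp: sensitive_def S_def)
        have "S \<inter> \<Union>\<B> = {}" using \<B>(2) by (auto simp: S_def)
        note fam = sensitive_family_insert[OF \<B>(1) S this]
        have "\<Union>(insert S \<B>) \<inter> K = {}"
          using \<B>(2) YX W(2) by (auto simp: S_def agree_on_def)
        from Suc.prems(2)[OF Y(1) YX Y(3) fam(1) this] show "card \<B> \<le> k"
          using fam(2) sensitive_family_finite[OF \<B>(1)] by simp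
      qed
    qed (use C Suc.prems in auto)
    then show ?thesis using C(2) by (auto intro: order_trans)
  next
    case False
    then show ?thesis by (intro exI[of _ "Answer False"]) auto
  qed
qed

lemma D_complexity_le_cube:
  assumes bs: "\<And>X \<B>. length X = N \<Longrightarrow> sensitive_family f X \<B> \<Longrightarrow> card \<B> \<le> b"
  shows "D_complexity N f \<le> b ^ 3"
proof -
  have "\<exists>t. queried_vars t \<subseteq> {..<N} \<and> depth t \<le> b * b\<^sup>2 \<and>
          (\<forall>Z. length Z = N \<longrightarrow> agree_on {} Z (replicate N False) \<longrightarrow> run_dtree t Z = f Z)"
  proof (rule exists_dtree_aux)
    fix X :: "bool list" assume "length X = N"
    with bs show "\<exists>C\<subseteq>{..<N}. card C \<le> b\<^sup>2 \<and>
        (\<forall>Y. length Y = N \<longrightarrow> agree_on C Y X \<longrightarrow> f Y = f X)"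
      by (rule exists_certificate)
  qed (use bs in auto)
  then obtain t where "dtree_computes N t f" and d: "depth t \<le> b ^ 3"
    by (auto simp: agree_on_def dtree_computes_def numeral_eq_Suc)
  then have "D_complexity N f \<le> depth t"
    unfolding D_complexity_def by (intro Least_le) blast
  with d show ?thesis by simp
qed

section \<open>Acceptance probabilities of quantum networks\<close>

lemma mat_adjoint_index:
  "i < dim_col A \<Longrightarrow> j < dim_row A \<Longrightarrow> mat_adjoint A $$ (i, j) = conjugate (A $$ (j, i))"
  by (simp add: mat_adjoint_def mat_of_rows_index)

lemma mat_adjoint_dim [simp]:
  "dim_row (mat_adjoint A) = dim_col A" "dim_col (mat_adjoint A) = dim_row A"
  by (simp_all add: mat_adjoint_def)

lemma mat_adjoint_mult_index:
  assumes "A \<in> carrier_mat n n" "a < n" "b < n"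
  shows "(mat_adjoint A * A) $$ (a, b) = (\<Sum>k<n. cnj (A $$ (k, a)) * A $$ (k, b))"
  using assms
  by (auto simp: scalar_prod_def mat_adjoint_index lessThan_atLeast0 intro!: sum.cong)

lemma unitary_mat_columns:
  assumes "unitary_mat n U" "a < n" "b < n"
  shows "(\<Sum>k<n. cnj (U $$ (k, a)) * U $$ (k, b)) = of_bool (a = b)"
proof -
  have U: "U \<in> carrier_mat n n" "mat_adjoint U * U = 1\<^sub>m n"
    using assms by (simp_all add: unitary_mat_def)
  show ?thesis
    unfolding mat_adjoint_mult_index[OF U(1) assms(2,3), symmetric] U(2) using assms by simp
qed

lemma mult_mat_vec_index:
  assumes "A \<in> carrier_mat n n" "v \<in> carrier_vec n" "i < n"
  shows "(A *\<^sub>v v) $ i = (\<Sum>k<n. A $$ (i, k) * v $ k)"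
  using assms by (auto simp: scalar_prod_def lessThan_atLeast0 intro!: sum.cong)

lemma unitary_mat_norm:
  assumes U: "unitary_mat n U" and v: "v \<in> carrier_vec n"
  shows "(\<Sum>k<n. (cmod ((U *\<^sub>v v) $ k))\<^sup>2) = (\<Sum>k<n. (cmod (v $ k))\<^sup>2)"
proof -
  have Uc: "U \<in> carrier_mat n n" using U by (simp add: unitary_mat_def)
  have "complex_of_real (\<Sum>k<n. (cmod ((U *\<^sub>v v) $ k))\<^sup>2)
      = (\<Sum>k<n. cnj ((U *\<^sub>v v) $ k) * (U *\<^sub>v v) $ k)"
    unfolding of_real_sum by (intro sum.cong refl) (simp only: complex_norm_square mult.commute)
  also have "\<dots> = (\<Sum>k<n. \<Sum>a<n. \<Sum>b<n.
      (cnj (v $ a) * v $ b) * (cnj (U $$ (k, a)) * U $$ (k, b)))"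
    by (intro sum.cong refl)
       (simp only: mult_mat_vec_index[OF Uc v] lessThan_iff cnj_sum complex_cnj_mult sum_product,
        simp add: mult_ac)
  also have "\<dots> = (\<Sum>a<n. \<Sum>k<n. \<Sum>b<n.
      (cnj (v $ a) * v $ b) * (cnj (U $$ (k, a)) * U $$ (k, b)))"
    by (rule sum.swap)
  also have "\<dots> = (\<Sum>a<n. \<Sum>b<n. \<Sum>k<n.
      (cnj (v $ a) * v $ b) * (cnj (U $$ (k, a)) * U $$ (k, b)))"
    by (intro sum.cong refl sum.swap)
  also have "\<dots> = (\<Sum>a<n. \<Sum>b<n. (cnj (v $ a) * v $ b) * of_bool (a = b))"
    by (intro sum.cong refl) (simp only: sum_distrib_left[symmetric] unitary_mat_columns[OF U] lessThan_iff)
  also have "\<dots> = (\<Sum>a<n. cnj (v $ a) * v $ a)"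
  proof (intro sum.cong refl)
    fix a assume "a \<in> {..<n}"
    moreover have "(cnj (v $ a) * v $ b) * of_bool (a = b) = (if a = b then cnj (v $ a) * v $ b else 0)" for b
      by simp
    ultimately show "(\<Sum>b<n. (cnj (v $ a) * v $ b) * of_bool (a = b)) = cnj (v $ a) * v $ a"
      by simp
  qed
  also have "\<dots> = complex_of_real (\<Sum>k<n. (cmod (v $ k))\<^sup>2)"
    unfolding of_real_sum by (intro sum.cong refl) (simp only: complex_norm_square mult.commute)
  finally show ?thesis by (simp only: of_real_eq_iff)
qed

definition perm_mat :: "nat \<Rightarrow> (nat \<Rightarrow> nat) \<Rightarrow> complex mat" where
  "perm_mat n \<pi> = mat n n (\<lambda>(r, c). if r = \<pi> c then 1 else 0)"

lemma unitary_perm_mat: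
  assumes \<pi>: "bij_betw \<pi> {..<n} {..<n}"
  shows "unitary_mat n (perm_mat n \<pi>)"
proof -
  have range: "\<pi> k < n" if "k < n" for k using bij_betwE[OF \<pi>] that by auto
  have inj: "\<pi> a = \<pi> b \<longleftrightarrow> a = b" if "a < n" "b < n" for a b
    using bij_betw_imp_inj_on[OF \<pi>] that by (auto dest: inj_onD)
  have c: "perm_mat n \<pi> \<in> carrier_mat n n" by (simp add: perm_mat_def)
  have "mat_adjoint (perm_mat n \<pi>) * perm_mat n \<pi> = 1\<^sub>m n"
  proof (rule eq_matI)
    fix a b assume "a < dim_row (1\<^sub>m n)" "b < dim_col (1\<^sub>m n)"
    then have ab: "a < n" "b < n" by simp_all
    have "(mat_adjoint (perm_mat n \<pi>) * perm_mat n \<pi>) $$ (a, b)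
        = (\<Sum>k<n. (if k = \<pi> a then if k = \<pi> b then 1 else 0 else 0))"
      unfolding mat_adjoint_mult_index[OF c ab]
      using ab by (intro sum.cong refl) (simp add: perm_mat_def)
    also have "\<dots> = (1\<^sub>m n) $$ (a, b)"
      using ab range inj by simp
    finally show "(mat_adjoint (perm_mat n \<pi>) * perm_mat n \<pi>) $$ (a, b) = (1\<^sub>m n) $$ (a, b)" .
  qed (simp_all add: perm_mat_def)
  note left = this
  have "mat_adjoint (perm_mat n \<pi>) \<in> carrier_mat n n"
    by (rule carrier_matI) (simp_all add: perm_mat_def)
  from mat_mult_left_right_inverse[OF this c left] left c show ?thesis
    by (simp add: unitary_mat_def)
qed

lemma perm_mat_mult_unit_vec:
  assumes "\<pi> k < n" "k < n"
  shows "perm_mat n \<pi> *\<^sub>v unit_vec n k = unit_vec n (\<pi> k)"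
proof (rule eq_vecI)
  fix i assume "i < dim_vec (unit_vec n (\<pi> k))"
  then have i: "i < n" by simp
  have "(perm_mat n \<pi> *\<^sub>v unit_vec n k) $ i = (\<Sum>j<n. perm_mat n \<pi> $$ (i, j) * unit_vec n k $ j)"
    using i by (intro mult_mat_vec_index) (auto simp: perm_mat_def)
  also have "\<dots> = (\<Sum>j<n. if j = k then of_bool (i = \<pi> k) else 0)"
  proof (intro sum.cong refl)
    fix j assume "j \<in> {..<n}"
    then have "perm_mat n \<pi> $$ (i, j) = of_bool (i = \<pi> j)" "(unit_vec n k :: complex vec) $ j = of_bool (j = k)"
      using i by (simp_all add: perm_mat_def unit_vec_def)
    then show "perm_mat n \<pi> $$ (i, j) * unit_vec n k $ j = (if j = k then of_bool (i = \<pi> k) else 0)"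
      by (cases "j = k") simp_all
  qed
  also have "\<dots> = of_bool (i = \<pi> k)" using assms(2) by simp
  also have "\<dots> = unit_vec n (\<pi> k) $ i" using i by (simp add: unit_vec_def)
  finally show "(perm_mat n \<pi> *\<^sub>v unit_vec n k) $ i = unit_vec n (\<pi> k) $ i" .
qed (simp add: perm_mat_def)

text \<open>Adding the queried bit twice modulo 2 cancels. The query is thus an involution on basis
  states, hence a permutation, which makes \<open>query_mat\<close> unitary.\<close>

lemma query_index_props:
  fixes N m :: nat
  defines "w \<equiv> m - index_bits N - 1"
  assumes m: "index_bits N + 1 \<le> m" and k: "k < 2 ^ m"
  shows "query_index N m X k < 2 ^ m" and "query_index N m X (query_index N m X k) = k"
proof -
  define z b i where "z = k mod 2 ^ w" and "b = k div 2 ^ w mod 2" and "i = k div 2 ^ w div 2"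
  have i': "k div 2 ^ (w + 1) = i"
    by (simp add: i_def div_mult2_eq[of k "2 ^ w" 2, symmetric] mult.commute)
  have k_eq: "k = (2 * i + b) * 2 ^ w + z"
  proof -
    have "2 * i + b = k div 2 ^ w" by (simp add: i_def b_def)
    then show ?thesis by (simp only: z_def div_mult_mod_eq)
  qed
  have dec: "((2 * i + b') * 2 ^ w + z) mod 2 ^ w = z"
    "((2 * i + b') * 2 ^ w + z) div 2 ^ w = 2 * i + b'" for b'
    by (simp_all add: z_def)
  have dec': "((2 * i + b') * 2 ^ w + z) div 2 ^ (w + 1) = i" if "b' < 2" for b'
  proof -
    have "((2 * i + b') * 2 ^ w + z) div 2 ^ (w + 1) = ((2 * i + b') * 2 ^ w + z) div 2 ^ w div 2"
      by (simp only: power_add power_one_right div_mult2_eq)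
    then show ?thesis using that unfolding dec by simp
  qed
  have eq: "query_index N m X ((2 * i + b') * 2 ^ w + z)
      = (if i < N then (2 * i + (b' + of_bool (X ! i)) mod 2) * 2 ^ w + z
         else (2 * i + b') * 2 ^ w + z)" if "b' < 2" for b'
    using that by (simp only: query_index_def Let_def w_def[symmetric] dec dec') simp
  have "b < 2" by (simp add: b_def)
  note q = eq[OF this, folded k_eq]
  \<comment> \<open>The index occupies the top \<open>m - w - 1\<close> bits, so changing the bit
    below it cannot leave the range.\<close>
  have "(2::nat) ^ m = 2 ^ (m - w - 1) * (2 * 2 ^ w)"
  proof -
    have "m = (m - w - 1) + (1 + w)" using m by (simp add: w_def)
    then have "(2::nat) ^ m = 2 ^ ((m - w - 1) + (1 + w))" by (rule arg_cong)
    then show ?thesis by (simp only: power_add power_one_right)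
  qed
  with k have "i < 2 ^ (m - w - 1)"
    unfolding i'[symmetric] by (simp add: less_mult_imp_div_less)
  then have "2 * i + 2 \<le> 2 * 2 ^ (m - w - 1)" by simp
  moreover have "(2 * i + b') * 2 ^ w + z < (2 * i + 2) * 2 ^ w" if "b' < 2" for b'
  proof -
    have "(2 * i + b') * 2 ^ w + z < (2 * i + b') * 2 ^ w + 2 ^ w" by (simp add: z_def)
    also have "\<dots> = (2 * i + b' + 1) * 2 ^ w" by simp
    also have "\<dots> \<le> (2 * i + 2) * 2 ^ w" using that by (intro mult_right_mono) auto
    finally show ?thesis .
  qed
  ultimately have bound: "(2 * i + b') * 2 ^ w + z < 2 ^ m" if "b' < 2" for b'
    using mult_le_mono1[of "2 * i + 2" "2 * 2 ^ (m - w - 1)" "2 ^ w"] that \<open>2 ^ m = _\<close>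
    by (fastforce intro: less_le_trans simp: mult_ac)
  show "query_index N m X k < 2 ^ m"
    unfolding q using bound[of "(b + of_bool (X ! i)) mod 2"] k by simp
  show "query_index N m X (query_index N m X k) = k"
  proof (cases "i < N")
    case True
    define b' where "b' = (b + of_bool (X ! i)) mod 2"
    have inv: "(b' + of_bool (X ! i)) mod 2 = b"
      using \<open>b < 2\<close> by (cases "X ! i") (auto simp: less_2_cases_iff b'_def)
    have "query_index N m X (query_index N m X k) = query_index N m X ((2 * i + b') * 2 ^ w + z)"
      by (simp only: q True if_True b'_def)
    also have "\<dots> = (2 * i + (b' + of_bool (X ! i)) mod 2) * 2 ^ w + z"
      using eq[of b'] True by (simp add: b'_def)
    also have "\<dots> = k" by (simp only: inv k_eq[symmetric])
    finally show ?thesis .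
  next
    case False
    then show ?thesis by (simp add: q)
  qed
qed

lemma query_mat_eq_perm_mat: "query_mat N m X = perm_mat (2 ^ m) (query_index N m X)"
  by (simp add: query_mat_def perm_mat_def)

lemma query_index_bij:
  assumes "index_bits N + 1 \<le> m"
  shows "bij_betw (query_index N m X) {..<2 ^ m} {..<2 ^ m}"
  using query_index_props[OF assms]
  by (intro bij_betw_byWitness[where f' = "query_index N m X"]) blast+

lemma unitary_query_mat: "index_bits N + 1 \<le> m \<Longrightarrow> unitary_mat (2 ^ m) (query_mat N m X)"
  unfolding query_mat_eq_perm_mat by (intro unitary_perm_mat query_index_bij)

lemma query_mat_carrier [simp]: "query_mat N m X \<in> carrier_mat (2 ^ m) (2 ^ m)"
  by (simp add: query_mat_def)

section \<open>Norm and multilinearity of network states\<close>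

lemma network_state_carrier:
  assumes "\<forall>j\<le>t. unitary_mat (2 ^ m) (U j)"
  shows "network_state N m U X t \<in> carrier_vec (2 ^ m)"
proof -
  have "dim_row (U t) = 2 ^ m" using assms by (auto simp: unitary_mat_def)
  moreover have "dim_vec (network_state N m U X t) = dim_row (U t)"
    by (cases t) (simp_all only: network_state.simps dim_mult_mat_vec)
  ultimately show ?thesis by (intro carrier_vecI) simp
qed

lemma network_state_norm:
  assumes "index_bits N + 1 \<le> m" "\<forall>j\<le>t. unitary_mat (2 ^ m) (U j)"
  shows "(\<Sum>k<2 ^ m. (cmod (network_state N m U X t $ k))\<^sup>2) = 1"
  using assms(2)
proof (induction t)
  case 0
  have "(\<Sum>k<2 ^ m. (cmod (unit_vec (2 ^ m) 0 $ k))\<^sup>2) = (\<Sum>k<2 ^ m. (if k = (0::nat) then 1 else 0))"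
    by (intro sum.cong refl) (simp add: unit_vec_def)
  then show ?case using 0 by (simp add: unitary_mat_norm)
next
  case (Suc t)
  have s: "network_state N m U X t \<in> carrier_vec (2 ^ m)"
    using Suc.prems by (intro network_state_carrier) auto
  have "query_mat N m X *\<^sub>v network_state N m U X t \<in> carrier_vec (2 ^ m)"
    by (rule mult_mat_vec_carrier[OF query_mat_carrier s])
  then show ?case
    using Suc unitary_mat_norm[OF unitary_query_mat[OF assms(1)] s] by (simp add: unitary_mat_norm)
qed

text \<open>A column reads at most one input bit, and by disjointness at most one block contains
  that bit, so the entry depends only on whether this block lies in \<open>S\<close>. Intersecting
  with \<open>\<B>\<close> makes this true of every \<open>S\<close>.\<close>

lemma query_mat_multilinear:
  assumes len: "length X = N" and \<B>: "disjoint \<B>" and rc: "r < 2 ^ m" "c < 2 ^ m"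
  shows "multilinear_degree_le 1 (\<lambda>S. query_mat N m (flip X (\<Union>(S \<inter> \<B>))) $$ (r, c))"
proof -
  define w i where "w = m - index_bits N - 1" and "i = c div 2 ^ (w + 1)"
  define h :: "bool \<Rightarrow> complex" where
    "h x = of_bool (r = (if i < N then (2 * i + (c div 2 ^ w mod 2 + of_bool x) mod 2) * 2 ^ w
                        + c mod 2 ^ w else c))" for x
  have entry: "query_mat N m Y $$ (r, c) = h (Y ! i)" for Y
    using rc by (simp add: query_mat_def query_index_def Let_def h_def w_def i_def)
  consider "i \<ge> N" | "i < N" "\<exists>B\<in>\<B>. i \<in> B" | "i < N" "\<forall>B\<in>\<B>. i \<notin> B" by fastforce
  then show ?thesis
  proof cases
    case 1
    then have "h = (\<lambda>_. h True)" by (simp add: h_def fun_eq_iff)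
    then have "(\<lambda>S. h (flip X (\<Union>(S \<inter> \<B>)) ! i)) = (\<lambda>S. h True)" by (auto dest: fun_cong)
    then show ?thesis unfolding entry by (simp only: multilinear_const)
  next
    case 2
    then obtain B where B: "B \<in> \<B>" "i \<in> B" by blast
    have uniq: "Q = B" if "Q \<in> \<B>" "i \<in> Q" for Q
      using disjointD[OF \<B> that(1) B(1)] that(2) B(2) by blast
    have mem: "i \<in> \<Union>(S \<inter> \<B>) \<longleftrightarrow> {B} \<subseteq> S" for S
    proof
      assume "i \<in> \<Union>(S \<inter> \<B>)"
      then obtain Q where "i \<in> Q" "Q \<in> S" "Q \<in> \<B>" by blast
      then show "{B} \<subseteq> S" using uniq[of Q] by simp
    next
      assume "{B} \<subseteq> S"
      then show "i \<in> \<Union>(S \<inter> \<B>)" using B by blast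
    qed
    have bit: "flip X (\<Union>(S \<inter> \<B>)) ! i = (X ! i \<noteq> ({B} \<subseteq> S))" for S
      unfolding mem[of S, symmetric] using 2(1) len by (intro nth_flip) simp
    \<comment> \<open>Linear interpolation between the unflipped and the flipped bit.\<close>
    have "h (flip X (\<Union>(S \<inter> \<B>)) ! i)
        = h (X ! i) + (h (\<not> X ! i) - h (X ! i)) * of_bool ({B} \<subseteq> S)" for S
      unfolding bit by (cases "{B} \<subseteq> S") simp_all
    then show ?thesis
      unfolding entry by (simp only:) (intro multilinear_add multilinear_const multilinear_monomial, auto)
  next
    case 3
    then have nin: "i \<notin> \<Union>(S \<inter> \<B>)" for S by blast
    have "flip X (\<Union>(S \<inter> \<B>)) ! i = (X ! i \<noteq> (i \<in> \<Union>(S \<inter> \<B>)))" for S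
      using 3(1) len by (intro nth_flip) simp
    then have "flip X (\<Union>(S \<inter> \<B>)) ! i = X ! i" for S using nin[of S] by blast
    then show ?thesis unfolding entry by (simp only: multilinear_const)
  qed
qed

text \<open>The unitaries contribute constant coefficients; each query multiplies amplitudes by
  entries of degree at most 1.\<close>

lemma network_state_multilinear:
  assumes len: "length X = N" and \<B>: "disjoint \<B>"
    and U: "\<forall>j\<le>t. unitary_mat (2 ^ m) (U j)" and k: "k < 2 ^ m"
  shows "multilinear_degree_le t (\<lambda>S. network_state N m U (flip X (\<Union>(S \<inter> \<B>))) t $ k)"
  using U k
proof (induction t arbitrary: k)
  case 0
  then show ?case by (simp add: multilinear_const)
next
  case (Suc t)
  define Y where "Y S = flip X (\<Union>(S \<inter> \<B>))" for S
  have Uc: "U (Suc t) \<in> carrier_mat (2 ^ m) (2 ^ m)" using Suc.prems by (simp add: unitary_mat_def)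
  have s: "network_state N m U (Y S) t \<in> carrier_vec (2 ^ m)" for S
    using Suc.prems by (intro network_state_carrier) auto
  have "network_state N m U (Y S) (Suc t) $ k
      = (\<Sum>a<2^m. U (Suc t) $$ (k, a) *
          (\<Sum>b<2^m. network_state N m U (Y S) t $ b * query_mat N m (Y S) $$ (a, b)))" for S
    using Suc.prems(2) mult_mat_vec_index[OF Uc mult_mat_vec_carrier[OF query_mat_carrier s]]
    by (simp add: mult_mat_vec_index[OF query_mat_carrier s] mult.commute)
  moreover have "multilinear_degree_le (Suc t) (\<lambda>S. \<Sum>a<2^m. U (Suc t) $$ (k, a) *
          (\<Sum>b<2^m. network_state N m U (Y S) t $ b * query_mat N m (Y S) $$ (a, b)))"
  proof (rule multilinear_sum)
    fix a :: nat assume a: "a \<in> {..<2 ^ m}"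
    have "multilinear_degree_le (0 + (t + 1)) (\<lambda>S. U (Suc t) $$ (k, a) *
          (\<Sum>b<2^m. network_state N m U (Y S) t $ b * query_mat N m (Y S) $$ (a, b)))"
      using a Suc.prems(1) unfolding Y_def
      by (intro multilinear_mult multilinear_const multilinear_sum Suc.IH
          query_mat_multilinear[OF len \<B>]) auto
    then show "multilinear_degree_le (Suc t) (\<lambda>S. U (Suc t) $$ (k, a) *
          (\<Sum>b<2^m. network_state N m U (Y S) t $ b * query_mat N m (Y S) $$ (a, b)))"
      by simp
  qed
  ultimately show ?case unfolding Y_def by simp
qed

lemma output_prob_multilinear:
  assumes len: "length X = N" and \<B>: "disjoint \<B>"
    and U: "\<forall>j\<le>T. unitary_mat (2 ^ m) (U j)"
  shows "multilinear_degree_le (2 * T)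
    (\<lambda>S. of_real (output_prob N m U T (flip X (\<Union>(S \<inter> \<B>))) c))"
proof -
  have "multilinear_degree_le (T + T) (\<lambda>S. \<Sum>k | k < 2 ^ m \<and> odd k = c.
      network_state N m U (flip X (\<Union>(S \<inter> \<B>))) T $ k
      * cnj (network_state N m U (flip X (\<Union>(S \<inter> \<B>))) T $ k))"
    using network_state_multilinear[OF len \<B> U]
    by (intro multilinear_sum multilinear_mult multilinear_cnj) auto
  then show ?thesis
    unfolding output_prob_def of_real_sum complex_norm_square by (simp only: mult_2)
qed

lemma output_prob_nonneg: "output_prob N m U T X c \<ge> 0"
  by (simp add: output_prob_def sum_nonneg)

lemma output_prob_add:
  assumes "index_bits N + 1 \<le> m" "\<forall>j\<le>T. unitary_mat (2 ^ m) (U j)"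
  shows "output_prob N m U T X c + output_prob N m U T X (\<not> c) = 1"
proof -
  have "{..<2 ^ m} = {k. k < 2 ^ m \<and> odd k = c} \<union> {k. k < (2::nat) ^ m \<and> odd k = (\<not> c)}" by auto
  then have "(\<Sum>k<2 ^ m. (cmod (network_state N m U X T $ k))\<^sup>2)
      = output_prob N m U T X c + output_prob N m U T X (\<not> c)"
    unfolding output_prob_def by (simp only:) (intro sum.union_disjoint, auto)
  then show ?thesis using network_state_norm[OF assms] by simp
qed

lemma card_sensitive_family_le:
  assumes net: "bounded_error_network N m U T f" and len: "length X = N"
    and sens: "sensitive_family f X \<B>"
  shows "card \<B> \<le> 12 * T\<^sup>2"
proof -
  have m: "index_bits N + 1 \<le> m" and U: "\<forall>j\<le>T. unitary_mat (2 ^ m) (U j)"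
    and succ: "\<And>Y. length Y = N \<Longrightarrow> output_prob N m U T Y (f Y) \<ge> 2 / 3"
    using net by (auto simp: bounded_error_network_def)
  have \<B>: "disjoint \<B>" using sens by (simp add: sensitive_family_def)
  define p where "p S = output_prob N m U T (flip X (\<Union>(S \<inter> \<B>))) (f X)" for S
  have ml: "multilinear_degree_le (2 * T) (\<lambda>S. of_real (p S))"
    unfolding p_def by (rule output_prob_multilinear[OF len \<B> U])
  have p01: "0 \<le> p S" "p S \<le> 1" for S
    using output_prob_nonneg[of N m U T "flip X (\<Union>(S \<inter> \<B>))"]
      output_prob_add[OF m U, of "flip X (\<Union>(S \<inter> \<B>))" "f X"]
    by (auto simp: p_def) (smt (verit))
  have p0: "p {} \<ge> 2 / 3" using succ[OF len] by (simp add: p_def)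
  have p1: "p {B} \<le> 1 / 3" if "B \<in> \<B>" for B
  proof -
    have "f (flip X B) = (\<not> f X)"
      using sens that by (auto simp: sensitive_family_def sensitive_def)
    moreover have "\<Union>({B} \<inter> \<B>) = B" using that by auto
    ultimately show ?thesis
      using succ[of "flip X B"] len output_prob_add[OF m U, of "flip X B" "f X"]
      by (simp add: p_def)
  qed
  show ?thesis
  \<comment> \<open>Interpolation needs a positive degree. Without queries the probability is
    constant and cannot fall from 2/3 to 1/3.\<close>
  proof (cases "T = 0")
    case True
    then have const: "p S = p {}" for S
      using multilinear_degree_0[of "\<lambda>S. of_real (p S)" S] ml by simp
    have "\<B> = {}"
    proof (rule equals0I)
      fix B assume "B \<in> \<B>"
      from p1[OF this] show False using p0 const[of "{B}"] by linarith
    qed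
    then show ?thesis by simp
  next
    case False
    have "real (card \<B>) / 3 = (\<Sum>B\<in>\<B>. 1 / 3)" by simp
    also have "\<dots> \<le> (\<Sum>B\<in>\<B>. p {} - p {B})"
    proof (rule sum_mono)
      fix B assume "B \<in> \<B>"
      then show "1 / 3 \<le> p {} - p {B}" using p0 p1[of B] by linarith
    qed
    also have "\<dots> \<le> \<bar>\<Sum>B\<in>\<B>. p {B} - p {}\<bar>"
      by (simp add: sum_subtractf)
    also have "\<dots> = norm (\<Sum>B\<in>\<B>. complex_of_real (p {B}) - of_real (p {}))"
      by (simp only: norm_of_real flip: of_real_diff of_real_sum)
    \<comment> \<open>The degree is \<open>2 * T\<close>, and centre and radius are 1/2 because
      probabilities lie in \<open>{0..1}\<close>. The bound 4 T^2 on a third of the cardinality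
      gives the factor 12.\<close>
    also have "\<dots> \<le> 2 * real ((2 * T)\<^sup>2) * (1 / 2)"
    proof (rule sum_differences_le_degree_squared[OF _ _ ml])
      show "norm (of_real (p S) - 1 / 2 :: complex) \<le> 1 / 2" for S
      proof -
        have "of_real (p S) - 1 / 2 = complex_of_real (p S - 1 / 2)" by simp
        then have "norm (of_real (p S) - 1 / 2 :: complex) = \<bar>p S - 1 / 2\<bar>"
          by (simp only: norm_of_real)
        then show ?thesis using p01[of S] by linarith
      qed
    qed (use False sensitive_family_finite[OF sens] in auto)
    finally have "real (card \<B>) \<le> real (12 * T\<^sup>2)" by (simp add: power_mult_distrib)
    then show ?thesis by (simp only: of_nat_le_iff)
  qed
qed

section \<open>Existence of networks\<close>

text \<open>The equivalence makes \<open>a x\<close> to \<open>b x\<close> a well-defined injection;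
  the complements of the two images have equal size, and any bijection between them completes
  it.\<close>

lemma exists_bij_extension:
  assumes F: "finite F" "a ` I \<subseteq> F" "b ` I \<subseteq> F"
    and ab: "\<And>x y. x \<in> I \<Longrightarrow> y \<in> I \<Longrightarrow> a x = a y \<longleftrightarrow> b x = b y"
  shows "\<exists>\<pi>. bij_betw \<pi> F F \<and> (\<forall>x\<in>I. \<pi> (a x) = b x)"
proof -
  define \<phi> where "\<phi> = b \<circ> inv_into I a"
  have \<phi>: "\<phi> (a x) = b x" if "x \<in> I" for x
    using that ab[of "inv_into I a (a x)" x] by (simp add: \<phi>_def inv_into_into f_inv_into_f)
  have "inj_on \<phi> (a ` I)" using ab by (auto simp: inj_on_def \<phi>)
  moreover have "\<phi> ` a ` I = b ` I" using \<phi> by (force simp: image_iff)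
  ultimately have bij1: "bij_betw \<phi> (a ` I) (b ` I)" by (simp add: bij_betw_def)
  then have "card (F - a ` I) = card (F - b ` I)"
    using F by (simp add: card_Diff_subset finite_subset bij_betw_same_card)
  then obtain \<psi> where bij2: "bij_betw \<psi> (F - a ` I) (F - b ` I)"
    using F finite_same_card_bij[of "F - a ` I" "F - b ` I"] by auto
  define \<pi> where "\<pi> y = (if y \<in> a ` I then \<phi> y else \<psi> y)" for y
  have "bij_betw \<pi> (a ` I) (b ` I)"
    using bij1 by (rule bij_betw_cong[THEN iffD1, rotated]) (simp add: \<pi>_def)
  moreover have "bij_betw \<pi> (F - a ` I) (F - b ` I)"
    using bij2 by (rule bij_betw_cong[THEN iffD1, rotated]) (simp add: \<pi>_def)
  ultimately have "bij_betw \<pi> (a ` I \<union> (F - a ` I)) (b ` I \<union> (F - b ` I))"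
    by (rule bij_betw_combine) blast
  then have "bij_betw \<pi> F F" using F by (simp add: Un_absorb1)
  moreover have "\<forall>x\<in>I. \<pi> (a x) = b x" using \<phi> by (simp add: \<pi>_def)
  ultimately show ?thesis by blast
qed

lemma le_power_index_bits:
  assumes "N \<ge> 1"
  shows "N \<le> 2 ^ index_bits N"
proof -
  have "log 2 (real N) \<le> real (index_bits N)"
    unfolding index_bits_def by linarith
  then have "2 powr log 2 (real N) \<le> 2 powr real (index_bits N)"
    by (intro powr_mono) simp_all
  then have "real N \<le> real (2 ^ index_bits N)"
    using assms by (simp add: powr_realpow)
  then show ?thesis by (simp only: of_nat_le_iff)
qed

lemma mult_add_eq_iff:
  fixes c :: nat
  assumes "c < W" "c' < W"
  shows "a * W + c = a' * W + c' \<longleftrightarrow> a = a' \<and> c = c'"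
proof
  assume eq: "a * W + c = a' * W + c'"
  have "(a * W + c) div W = a" "(a' * W + c') div W = a'" using assms by simp_all
  with eq show "a = a' \<and> c = c'" by simp
qed simp

text \<open>
  The network queries the bits one after the other. Each unitary is a permutation of the basis
  states, so it may depend on the bits seen so far as long as the state keeps a record of them;
  before the measurement \<open>f X\<close> is written to the rightmost bit next to a record of all of \<open>X\<close>.
\<close>

lemma exists_bounded_error_network:
  assumes N: "N \<ge> 1"
  shows "\<exists>m U. bounded_error_network N m U N f"
proof -
  \<comment> \<open>Codes are even so that the rightmost bit stays free for
    \<open>f X\<close>.\<close>
  define code :: "bool list \<Rightarrow> nat" where "code X = 2 * to_nat X" for X
  define L where "L = {X :: bool list. length X \<le> N}"
  have "finite L" using finite_lists_length_le[of "UNIV :: bool set" N] by (simp add: L_def)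
  define w where "w = Suc (Max (code ` L))"
  have code: "code X + 1 < 2 ^ w" if "length X \<le> N" for X
  proof -
    have "code X \<le> Max (code ` L)" using that \<open>finite L\<close> by (simp add: L_def)
    also have "\<dots> < 2 ^ Max (code ` L)" by (rule less_exp)
    finally show ?thesis by (simp add: w_def)
  qed
  define m where "m = index_bits N + 1 + w"
  have m: "index_bits N + 1 \<le> m" and w: "m - index_bits N - 1 = w" by (simp_all add: m_def)
  have W: "2 ^ m = 2 ^ index_bits N * (2 * 2 ^ w :: nat)" by (simp add: m_def power_add)
  define I where "I = {X :: bool list. length X = N}"
  \<comment> \<open>For \<open>t < N\<close>, \<open>st t X\<close> asks for bit \<open>t\<close>
    with target bit 0 and a record of the first \<open>t\<close> bits, and \<open>post t X\<close>
    is the result of that query. \<open>st N X\<close> is the final state.\<close>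
  define st where "st t X = (if t < N then (2 * t) * 2 ^ w + code (take t X)
      else code X + of_bool (f X))" for t X
  define post where "post t X = (2 * t + of_bool (X ! t)) * 2 ^ w + code (take t X)" for t X
  have code': "code (take t X) < 2 ^ w" if "X \<in> I" for t X
    using code[of "take t X"] that by (simp add: I_def)
  have bound: "(2 * t + of_bool b) * 2 ^ w + c < 2 ^ m" if "t < N" "c < 2 ^ w" for t c b
  proof -
    have "(2 * t + of_bool b) * 2 ^ w + c < (2 * t + of_bool b + 1) * 2 ^ w" using that by simp
    also have "\<dots> \<le> (2 * N) * 2 ^ w" using that by (intro mult_right_mono) (cases b, auto)
    also have "\<dots> \<le> 2 ^ m" using le_power_index_bits[OF N] unfolding W by simp
    finally show ?thesis .
  qed
  have post_less: "post t X < 2 ^ m" if "t < N" "X \<in> I" for t X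
    using bound[OF that(1) code'[OF that(2)]] by (simp only: post_def)
  have st_less: "st t X < 2 ^ m" if "X \<in> I" for t X
  proof (cases "t < N")
    case True
    then show ?thesis using bound[OF True code'[OF that], of False] by (simp add: st_def)
  next
    case False
    have "code X + of_bool (f X) \<le> code X + 1" by simp
    also have "\<dots> < 2 ^ w" using that by (intro code) (simp add: I_def)
    also have "(2::nat) ^ w \<le> 2 ^ m" by (intro power_increasing) (simp_all add: m_def)
    finally show ?thesis using False by (simp add: st_def)
  qed
  have query: "query_index N m X (st t X) = post t X" if t: "t < N" and X: "X \<in> I" for t X
  proof -
    have c: "code (take t X) < 2 ^ w" using code' X by blast
    have div: "st t X div 2 ^ w = 2 * t" "st t X mod 2 ^ w = code (take t X)"
      using t c by (simp_all add: st_def)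
    have div': "st t X div 2 ^ (w + 1) = t"
      by (simp only: power_add power_one_right div_mult2_eq div)
    show ?thesis
      unfolding query_index_def Let_def w div div' post_def using t by simp
  qed
  \<comment> \<open>Both sides say that \<open>X\<close> and \<open>Y\<close> share their first
    \<open>t + 1\<close> bits, so mapping \<open>post t X\<close> to \<open>st (Suc t) X\<close>
    extends to a permutation.\<close>
  have inj: "post t X = post t Y \<longleftrightarrow> st (Suc t) X = st (Suc t) Y"
    if t: "t < N" and XY: "X \<in> I" "Y \<in> I" for t X Y
  proof -
    have len: "length X = N" "length Y = N" using XY by (simp_all add: I_def)
    have "post t X = post t Y \<longleftrightarrow> X ! t = Y ! t \<and> take t X = take t Y"
      unfolding post_def mult_add_eq_iff[OF code'[OF XY(1)] code'[OF XY(2)]]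
      by (cases "X ! t"; cases "Y ! t") (auto simp: code_def)
    also have "\<dots> \<longleftrightarrow> take (Suc t) X = take (Suc t) Y"
      using t len by (auto simp: take_Suc_conv_app_nth)
    also have "\<dots> \<longleftrightarrow> st (Suc t) X = st (Suc t) Y"
    proof (cases "Suc t < N")
      case True
      then show ?thesis by (simp add: st_def code_def)
    next
      case False
      then have "Suc t = N" using t by simp
      moreover have "2 * to_nat X + of_bool (f X) = 2 * to_nat Y + of_bool (f Y) \<longleftrightarrow> X = Y"
        using mult_add_eq_iff[of "of_bool (f X)" 2 "of_bool (f Y)" "to_nat X" "to_nat Y"]
        by (auto simp: mult.commute)
      ultimately show ?thesis using len by (simp add: st_def code_def)
    qed
    finally show ?thesis .
  qed
  define before where "before j X = (case j of 0 \<Rightarrow> 0 | Suc t \<Rightarrow> post t X)" for j X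
  have "\<exists>\<pi>. j \<le> N \<longrightarrow> bij_betw \<pi> {..<2 ^ m} {..<2 ^ m} \<and> (\<forall>X\<in>I. \<pi> (before j X) = st j X)" for j
  proof (cases "j \<le> N")
    case True
    have "\<exists>\<pi>. bij_betw \<pi> {..<2 ^ m} {..<2 ^ m} \<and> (\<forall>X\<in>I. \<pi> (before j X) = st j X)"
    proof (rule exists_bij_extension)
      show "st j ` I \<subseteq> {..<2 ^ m}" using st_less by auto
      show "before j ` I \<subseteq> {..<2 ^ m}"
        using post_less True by (auto simp: before_def split: nat.split)
      show "before j X = before j Y \<longleftrightarrow> st j X = st j Y" if "X \<in> I" "Y \<in> I" for X Y
      proof (cases j)
        case 0
        \<comment> \<open>Neither the initial state 0 nor \<open>st 0 X\<close>, which encodes the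
          empty record because \<open>N > 0\<close>, depends on \<open>X\<close>.\<close>
        then show ?thesis using N by (simp add: before_def st_def)
      next
        case (Suc t)
        then show ?thesis using inj[of t X Y] True that by (simp add: before_def)
      qed
    qed simp
    then show ?thesis by blast
  qed simp
  then obtain \<pi> where bij: "\<And>j. j \<le> N \<Longrightarrow> bij_betw (\<pi> j) {..<2 ^ m} {..<2 ^ m}"
    and \<pi>: "\<And>j X. j \<le> N \<Longrightarrow> X \<in> I \<Longrightarrow> \<pi> j (before j X) = st j X"
    by metis
  define U where "U j = perm_mat (2 ^ m) (\<pi> j)" for j
  have state: "network_state N m U X t = unit_vec (2 ^ m) (st t X)" if "t \<le> N" "X \<in> I" for t X
    using that(1)
  proof (induction t)
    case 0
    have "\<pi> 0 0 = st 0 X" using \<pi>[of 0 X] that by (simp add: before_def)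
    then show ?case
      using perm_mat_mult_unit_vec[of "\<pi> 0" 0 "2 ^ m"] st_less[of X 0] that by (simp add: U_def)
  next
    case (Suc t)
    have "\<pi> (Suc t) (post t X) = st (Suc t) X"
      using \<pi>[OF Suc.prems that(2)] by (simp add: before_def)
    then show ?case
      using Suc query[of t X] post_less[of t X] st_less[of X] that(2)
      by (simp add: U_def query_mat_eq_perm_mat perm_mat_mult_unit_vec)
  qed
  have "output_prob N m U N X (f X) \<ge> 1" if "length X = N" for X
  proof -
    have X: "X \<in> I" using that by (simp add: I_def)
    have st: "st N X < 2 ^ m" "odd (st N X) = f X"
      by (rule st_less[OF X]) (simp add: st_def code_def)
    have "(1::real) = (cmod (unit_vec (2 ^ m) (st N X) $ st N X))\<^sup>2"
      using st by (simp add: unit_vec_def)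
    also have "\<dots> \<le> (\<Sum>k | k < 2 ^ m \<and> odd k = f X. (cmod (unit_vec (2 ^ m) (st N X) $ k))\<^sup>2)"
      using st by (intro member_le_sum) auto
    finally show ?thesis using state[OF order_refl X] by (simp add: output_prob_def)
  qed
  then have "output_prob N m U N X (f X) \<ge> 2 / 3" if "length X = N" for X
    using that by fastforce
  moreover have "unitary_mat (2 ^ m) (U j)" if "j \<le> N" for j
    unfolding U_def by (rule unitary_perm_mat[OF bij[OF that]])
  ultimately have "bounded_error_network N m U N f"
    using m by (simp add: bounded_error_network_def)
  then show ?thesis by blast
qed

section \<open>Decision tree depth and quantum query complexity\<close>

theorem theorem5p4:
  fixes N :: nat and f :: "bool list \<Rightarrow> bool"
  assumes "N \<ge> 1"
  shows "D_complexity N f \<le> 4096 * Q2_complexity N f ^ 6"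
proof -
  define T where "T = Q2_complexity N f"
  \<comment> \<open>\<open>LEAST\<close> is attained only because some number of queries
    suffices.\<close>
  have "\<exists>m U. bounded_error_network N m U T f"
    unfolding T_def Q2_complexity_def
    by (rule LeastI[of "\<lambda>T. \<exists>m U. bounded_error_network N m U T f",
          OF exists_bounded_error_network[OF assms]])
  then obtain m U where net: "bounded_error_network N m U T f" by blast
  have "D_complexity N f \<le> (12 * T\<^sup>2) ^ 3"
    using card_sensitive_family_le[OF net] by (rule D_complexity_le_cube)
  \<comment> \<open>The argument gives 12^3 = 1728; the claimed constant is 16^3 = 4096.\<close>
  also have "\<dots> \<le> (16 * T\<^sup>2) ^ 3" by (intro power_mono) simp_all
  also have "\<dots> = 4096 * T ^ 6" using power_mult[of T 2 3] by (simp add: power_mult_distrib)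
  finally show ?thesis by (simp add: T_def)
qed

end
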